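(* Let $d>0$ be a real number and let $a$ be a quantum multigraph. Then $t(a)\ge 0$ holds for every isolate indifferent, flatly reflection positive and $d$-bounded graph parameter $t$ if and only if for every $\epsilon>0$ there exists $r\in\mathbb N$ such that $$a+\epsilon\left(1+\frac{1}{d^{2r}}K_2^{2r}\right)$$ coincides, up to labels and isolated vertices, with a sum of squares of elements of $\mathcal A_r^0$.
   Context: All graphs are finite, undirected and loopless, but may have multiple edges. A $k$-labeled graph is a graph in which $k$ different vertices are labeled $1,\dots,k$ (a $0$-labeled graph is an unlabeled graph). Let $\mathcal G_k$ be the set of isomorphism classes (respecting labels) of $k$-labeled graphs. The product of $F,G\in\mathcal G_k$ is obtained by taking the disjoint union and identifying vertices with the same label, keeping all edges with multiplicity. This makes $\mathcal G_k$ an abelian monoid whose identity is the graph with vertices $1,\dots,k$ and no edges (the empty graph if $k=0$). Let $\mathcal A_k$ be the monoid algebra of $\mathcal G_k$ over $\mathbb R$. A quantum multigraph is an element of $\mathcal A_0$, i.e. a finite formal real linear combination of unlabeled multigraphs; the symbol $1$ in the displayed expression is the identity element of $\mathcal A_0$. Let $\mathcal A_k^0\subseteq\mathcal A_k$ be the subalgebra spanned by the $k$-labeled graphs all of whose vertices are labeled; it is the polynomial algebra $\mathbb R[z_{ij}\mid 1\le i<j\le k]$, where $z_{ij}$ is the graph on the labeled vertices $1,\dots,k$ whose only edge is a single edge $ij$. $K_2^j$ denotes the (unlabeled) graph with two vertices and $j$ edges between them. A graph parameter is a map $t:\mathcal G_0\to\mathbb R$; ignoring labels and extending linearly, it defines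 linear functionals $t:\mathcal A_k\to\mathbb R$ for all $k$. It is isolate indifferent if its value at a graph does not change when an isolated vertex is added; flatly reflection positive if $t(b^2)\ge 0$ for all $b\in\mathcal A_k^0$ and all $k$; $d$-bounded if $|t(K_2^k)|\le d^k$ for all $k\ge 0$. Two elements of (possibly different) algebras $\mathcal A_k,\mathcal A_l$ coincide up to labels and isolated vertices if, after forgetting all labels (giving elements of $\mathcal A_0$), they become equal when each graph is identified with every graph obtained from it by adding or removing isolated vertices; i.e. they are equal modulo the linear span of all $G\sqcup K_1-G$, where $G$ ranges over unlabeled multigraphs (including the empty graph) and $K_1$ is the one-vertex graph. *)

theory Defs
  imports "HOL-Analysis.Finite_Function_Topology" "HOL-Library.Multiset"
begin

text \<open>
  The vertex carrying label \<open>i\<close> is named \<open>Labeled i\<close>, so that the labels of a graph are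
  determined by its vertex set and distinct labels sit on distinct vertices.
  The vertices without label are named \<open>Unlabeled j\<close>; their names are irrelevant, since
  graphs are taken up to label-preserving isomorphism below.
\<close>
datatype vertex = Labeled nat | Unlabeled nat

text \<open>
  A graph is given by its vertex set and the multiset of its edges; an edge is the set of its
  two (distinct) end points.
\<close>
type_synonym pregraph = "vertex set \<times> vertex set multiset"

definition multigraph :: "pregraph \<Rightarrow> bool" where
  "multigraph G \<longleftrightarrow> finite (fst G) \<and> (\<forall>e\<in>#snd G. e \<subseteq> fst G \<and> card e = 2)"

definition map_graph :: "(vertex \<Rightarrow> vertex) \<Rightarrow> pregraph \<Rightarrow> pregraph" where
  "map_graph f G = (f ` fst G, image_mset ((`) f) (snd G))"

definition preserves_labels :: "(vertex \<Rightarrow> vertex) \<Rightarrow> vertex set \<Rightarrow> bool" where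
  "preserves_labels f V \<longleftrightarrow> (\<forall>v\<in>V. \<forall>i. f v = Labeled i \<longleftrightarrow> v = Labeled i)"

definition isomorphic :: "pregraph \<Rightarrow> pregraph \<Rightarrow> bool" where
  "isomorphic G H \<longleftrightarrow>
     (\<exists>f. inj_on f (fst G) \<and> preserves_labels f (fst G) \<and> H = map_graph f G)"

text \<open>
  Vertices with the same label are identified by the union of the vertex sets, after the
  unlabeled vertices have been made disjoint.
\<close>
fun shift :: "nat \<Rightarrow> vertex \<Rightarrow> vertex" where
  "shift c (Labeled i) = Labeled i"
| "shift c (Unlabeled j) = Unlabeled (2 * j + c)"

definition glue :: "pregraph \<Rightarrow> pregraph \<Rightarrow> pregraph" where
  "glue G H = (fst (map_graph (shift 0) G) \<union> fst (map_graph (shift 1) H),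
               snd (map_graph (shift 0) G) + snd (map_graph (shift 1) H))"

fun strip_label :: "vertex \<Rightarrow> vertex" where
  "strip_label (Labeled i) = Unlabeled (2 * i)"
| "strip_label (Unlabeled j) = Unlabeled (2 * j + 1)"

lemma inj_strip_label: "inj strip_label"
proof (rule injI)
  fix x y assume "strip_label x = strip_label y"
  then show "x = y" by (cases x; cases y; simp; presburger)
qed

lemma inj_shift: "inj (shift c)"
proof (rule injI)
  fix x y assume "shift c x = shift c y"
  then show "x = y" by (cases x; cases y; simp)
qed

lemma shift_preserves_labels: "preserves_labels (shift c) V"
  unfolding preserves_labels_def
proof (intro ballI allI)
  fix v i show "shift c v = Labeled i \<longleftrightarrow> v = Labeled i" by (cases v) auto
qed

lemma map_graph_comp: "map_graph g (map_graph f G) = map_graph (g \<circ> f) G"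
  by (simp add: map_graph_def image_image image_comp multiset.map_comp o_def)

lemma multigraph_map:
  assumes "multigraph G" "inj_on f (fst G)"
  shows "multigraph (map_graph f G)"
proof -
  have "card (f ` e) = 2" if "e \<in># snd G" for e
    using that assms by (metis multigraph_def card_image inj_on_subset)
  with assms show ?thesis by (auto simp: multigraph_def map_graph_def)
qed

lemma map_graph_cong:
  assumes "multigraph G" "\<And>v. v \<in> fst G \<Longrightarrow> f v = g v"
  shows "map_graph f G = map_graph g G"
proof -
  have "f ` e = g ` e" if "e \<in># snd G" for e
    using that assms by (intro image_cong) (auto simp: multigraph_def)
  then show ?thesis using assms(2)
    by (simp add: map_graph_def cong: image_cong image_mset_cong)
qed

lemma isomorphicI:
  "inj_on f (fst G) \<Longrightarrow> preserves_labels f (fst G) \<Longrightarrow> map_graph f G = H \<Longrightarrow> isomorphic G H"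
  unfolding isomorphic_def by blast

lemma isomorphic_refl: "isomorphic G G"
  by (rule isomorphicI[where f = id]) (auto simp: preserves_labels_def map_graph_def)

lemma isomorphic_sym:
  assumes "multigraph G" "isomorphic G H"
  shows "isomorphic H G"
proof -
  obtain f where f: "inj_on f (fst G)" "preserves_labels f (fst G)" "H = map_graph f G"
    using assms by (auto simp: isomorphic_def)
  let ?g = "inv_into (fst G) f"
  have "map_graph ?g H = map_graph (?g \<circ> f) G" by (simp add: f map_graph_comp)
  also have "\<dots> = map_graph id G"
    using assms(1) f(1) by (intro map_graph_cong) auto
  finally have "map_graph ?g H = G" by (simp add: map_graph_def)
  moreover have "inj_on ?g (fst H)" by (simp add: f map_graph_def inj_on_inv_into)
  moreover have "preserves_labels ?g (fst H)"
    using f by (auto simp: preserves_labels_def map_graph_def)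
  ultimately show ?thesis by (intro isomorphicI)
qed

lemma isomorphic_trans:
  assumes "isomorphic G H" "isomorphic H K"
  shows "isomorphic G K"
proof -
  obtain f g where f: "inj_on f (fst G)" "preserves_labels f (fst G)" "H = map_graph f G"
    and g: "inj_on g (fst H)" "preserves_labels g (fst H)" "K = map_graph g H"
    using assms by (auto simp: isomorphic_def)
  show ?thesis
  proof (rule isomorphicI[where f = "g \<circ> f"])
    show "inj_on (g \<circ> f) (fst G)" using f g by (auto simp: map_graph_def intro: comp_inj_on)
    show "preserves_labels (g \<circ> f) (fst G)" using f g by (auto simp: preserves_labels_def map_graph_def)
    show "map_graph (g \<circ> f) G = K" by (simp add: f g map_graph_comp)
  qed
qed

lemma multigraph_glue:
  assumes "multigraph G" "multigraph H"
  shows "multigraph (glue G H)"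
  using multigraph_map[OF assms(1) inj_on_subset[OF inj_shift[of 0] subset_UNIV]]
    multigraph_map[OF assms(2) inj_on_subset[OF inj_shift[of 1] subset_UNIV]]
  by (auto simp: glue_def multigraph_def)

lemma map_glue:
  "map_graph h (glue G H) =
     (fst (map_graph (h \<circ> shift 0) G) \<union> fst (map_graph (h \<circ> shift 1) H),
      snd (map_graph (h \<circ> shift 0) G) + snd (map_graph (h \<circ> shift 1) H))"
  by (simp add: glue_def map_graph_def image_Un image_image image_comp multiset.map_comp o_def)

lemma glue_commute: "isomorphic (glue G H) (glue H G)"
proof -
  define h where "h = (\<lambda>v. case v of Labeled i \<Rightarrow> Labeled i
    | Unlabeled n \<Rightarrow> Unlabeled (if even n then n + 1 else n - 1))"
  have c: "h \<circ> shift 0 = shift 1" "h \<circ> shift 1 = shift 0"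
  proof -
    show "h \<circ> shift 0 = shift 1"
    proof
      fix v show "(h \<circ> shift 0) v = shift 1 v" by (cases v) (auto simp: h_def)
    qed
    show "h \<circ> shift 1 = shift 0"
    proof
      fix v show "(h \<circ> shift 1) v = shift 0 v" by (cases v) (auto simp: h_def)
    qed
  qed
  have inj: "inj h"
  proof (rule injI)
    fix x y assume "h x = h y"
    then show "x = y" by (cases x; cases y; simp add: h_def split: if_splits; presburger)
  qed
  show ?thesis
  proof (rule isomorphicI[where f = h])
    show "inj_on h (fst (glue G H))" using inj by (rule inj_on_subset) simp
    show "preserves_labels h (fst (glue G H))"
      by (auto simp: preserves_labels_def h_def split: vertex.splits)
    show "map_graph h (glue G H) = glue H G"
      unfolding map_glue c by (simp add: glue_def Un_commute add.commute)
  qed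
qed

lemma glue_assoc: "isomorphic (glue (glue G H) K) (glue G (glue H K))"
proof -
  define h where "h = (\<lambda>v. case v of Labeled i \<Rightarrow> Labeled i
    | Unlabeled n \<Rightarrow> Unlabeled (if n mod 4 = 0 then n div 2
                                else if n mod 4 = 2 then n - 1 else 2 * n + 1))"
  have c: "h \<circ> (shift 0 \<circ> shift 0) = shift 0" "h \<circ> (shift 0 \<circ> shift 1) = shift 1 \<circ> shift 0"
    "h \<circ> shift 1 = shift 1 \<circ> shift 1"
  proof -
    have "2 * (2 * j) mod 4 = 0" "(2 * (2 * j + 1)) mod 4 = 2" "odd ((2 * j + 1) mod 4)" for j :: nat
      by presburger+
    note m = this
    show "h \<circ> (shift 0 \<circ> shift 0) = shift 0"
    proof
      fix v show "(h \<circ> (shift 0 \<circ> shift 0)) v = shift 0 v"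
        using m by (cases v) (auto simp: h_def)
    qed
    show "h \<circ> (shift 0 \<circ> shift 1) = shift 1 \<circ> shift 0"
    proof
      fix v show "(h \<circ> (shift 0 \<circ> shift 1)) v = (shift 1 \<circ> shift 0) v"
      proof (cases v)
        case (Unlabeled j)
        then show ?thesis using m(2)[of j] by (simp add: h_def)
      qed (simp add: h_def)
    qed
    show "h \<circ> shift 1 = shift 1 \<circ> shift 1"
    proof
      fix v show "(h \<circ> shift 1) v = (shift 1 \<circ> shift 1) v"
      proof (cases v)
        case (Unlabeled j)
        have "(2 * j + 1) mod 4 \<noteq> 0" "(2 * j + 1) mod 4 \<noteq> 2" by presburger+
        then show ?thesis using Unlabeled by (simp add: h_def)
      qed (simp add: h_def)
    qed
  qed
  have inj: "inj h"
  proof (rule injI)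
    define q where "q = (\<lambda>n::nat. if even n then 2 * n
      else if n mod 4 = 1 then n + 1 else (n - 1) div 2)"
    have q: "q (if n mod 4 = 0 then n div 2 else if n mod 4 = 2 then n - 1 else 2 * n + 1) = n" for n
    proof -
      have "(\<exists>j. n = 4 * j) \<or> (\<exists>j. n = 4 * j + 2) \<or> (\<exists>j. n = 2 * j + 1)" by presburger
      then consider j where "n = 4 * j" | j where "n = 4 * j + 2" | j where "n = 2 * j + 1"
        by blast
      then show ?thesis
      proof cases
        case (1 j)
        then show ?thesis by (simp add: q_def)
      next
        case (2 j)
        have "(4 * j + 2) mod 4 = 2" "(4 * j + 1) mod 4 = 1" by presburger+
        with 2 show ?thesis by (simp add: q_def)
      next
        case (3 j)
        have "(2 * j + 1) mod 4 \<noteq> 0" "(2 * j + 1) mod 4 \<noteq> 2"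
          "(2 * (2 * j + 1) + 1) mod 4 \<noteq> 1" by presburger+
        with 3 show ?thesis by (simp add: q_def)
      qed
    qed
    fix x y assume e: "h x = h y"
    show "x = y"
    proof (cases x)
      case (Labeled i)
      with e show ?thesis by (cases y) (simp_all add: h_def)
    next
      case X: (Unlabeled n)
      show ?thesis
      proof (cases y)
        case (Labeled i)
        with e X show ?thesis by (simp add: h_def)
      next
        case Y: (Unlabeled m)
        have "(if n mod 4 = 0 then n div 2 else if n mod 4 = 2 then n - 1 else 2 * n + 1)
            = (if m mod 4 = 0 then m div 2 else if m mod 4 = 2 then m - 1 else 2 * m + 1)"
          using e unfolding h_def X Y vertex.case vertex.inject .
        from arg_cong[where f = q, OF this] have "n = m" unfolding q .
        with X Y show ?thesis by simp
      qed
    qed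
  qed
  show ?thesis
  proof (rule isomorphicI[where f = h])
    show "inj_on h (fst (glue (glue G H) K))" using inj by (rule inj_on_subset) simp
    show "preserves_labels h (fst (glue (glue G H) K))"
      by (auto simp: preserves_labels_def h_def split: vertex.splits)
    show "map_graph h (glue (glue G H) K) = glue G (glue H K)"
      unfolding map_glue comp_assoc c
      by (simp add: glue_def[of G] map_glue Un_assoc add.assoc)
  qed
qed

lemma glue_cong_left:
  assumes "multigraph G" "isomorphic G G'"
  shows "isomorphic (glue G H) (glue G' H)"
proof -
  obtain f where f: "inj_on f (fst G)" "preserves_labels f (fst G)" "G' = map_graph f G"
    using assms by (auto simp: isomorphic_def)
  define h where "h = (\<lambda>v. case v of Labeled i \<Rightarrow> Labeled i
    | Unlabeled n \<Rightarrow> if even n then shift 0 (f (Unlabeled (n div 2))) else Unlabeled n)"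
  have f_lab: "f (Labeled i) = Labeled i" if "Labeled i \<in> fst G" for i
    using f(2) that by (auto simp: preserves_labels_def)
  have f_unl: "\<exists>k. f (Unlabeled j) = Unlabeled k" if "Unlabeled j \<in> fst G" for j
    using f(2) that by (cases "f (Unlabeled j)") (auto simp: preserves_labels_def)
  have h0: "(h \<circ> shift 0) v = (shift 0 \<circ> f) v" if "v \<in> fst G" for v
    using that f_lab by (cases v) (auto simp: h_def)
  have h1: "h \<circ> shift 1 = shift 1"
  proof
    fix v show "(h \<circ> shift 1) v = shift 1 v" by (cases v) (auto simp: h_def)
  qed
  have V: "fst (glue G H) = shift 0 ` fst G \<union> shift 1 ` fst H"
    by (simp add: glue_def map_graph_def)
  have lab: "h x = Labeled i \<longleftrightarrow> x = Labeled i" if "x \<in> fst (glue G H)" for x i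
    using that unfolding V
  proof
    assume "x \<in> shift 0 ` fst G"
    then obtain v where v: "v \<in> fst G" "x = shift 0 v" by auto
    then have "h x = shift 0 (f v)" using h0 by fastforce
    with v f_lab f_unl show ?thesis by (cases v) fastforce+
  next
    assume "x \<in> shift 1 ` fst H"
    then obtain v where v: "v \<in> fst H" "x = shift 1 v" by auto
    then have "h x = x" using h1 by (metis comp_apply)
    then show ?thesis by simp
  qed
  have par: "\<exists>m. h (Unlabeled n) = Unlabeled m \<and> even m = even n"
    if "Unlabeled n \<in> fst (glue G H)" for n
  proof (cases "even n")
    case True
    have "Unlabeled (n div 2) \<in> fst G"
      using that unfolding V
    proof
      assume "Unlabeled n \<in> shift 0 ` fst G"
      then obtain v where "v \<in> fst G" "Unlabeled n = shift 0 v" by auto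
      then show ?thesis by (cases v) auto
    next
      assume "Unlabeled n \<in> shift 1 ` fst H"
      then obtain v where "v \<in> fst H" "Unlabeled n = shift 1 v" by auto
      then show ?thesis using True by (cases v) auto
    qed
    then show ?thesis using True f_unl by (fastforce simp: h_def)
  qed (simp add: h_def)
  have even_in: "Unlabeled (n div 2) \<in> fst G"
    if n: "Unlabeled n \<in> fst (glue G H)" "even n" for n
    using n(1) unfolding V
  proof
    assume "Unlabeled n \<in> shift 0 ` fst G"
    then obtain v where "v \<in> fst G" "Unlabeled n = shift 0 v" by auto
    then show ?thesis by (cases v) auto
  next
    assume "Unlabeled n \<in> shift 1 ` fst H"
    then obtain v where "v \<in> fst H" "Unlabeled n = shift 1 v" by auto
    then show ?thesis using n(2) by (cases v) auto
  qed
  have inj: "inj_on h (fst (glue G H))"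
  proof (rule inj_onI)
    fix x y assume x: "x \<in> fst (glue G H)" and y: "y \<in> fst (glue G H)" and e: "h x = h y"
    show "x = y"
    proof (cases x)
      case (Labeled i)
      then show ?thesis using lab[OF x, of i] lab[OF y, of i] e by auto
    next
      case X: (Unlabeled n)
      show ?thesis
      proof (cases y)
        case (Labeled i)
        then show ?thesis using lab[OF x, of i] lab[OF y, of i] e by auto
      next
        case Y: (Unlabeled m)
        have ev: "even n = even m"
          using par[of n] par[of m] x y e X Y by fastforce
        show ?thesis
        proof (cases "even n")
          case True
          then have *: "Unlabeled (n div 2) \<in> fst G" "Unlabeled (m div 2) \<in> fst G"
            using even_in x y X Y ev by auto
          have "shift 0 (f (Unlabeled (n div 2))) = shift 0 (f (Unlabeled (m div 2)))"
            using e True ev by (simp add: X Y h_def)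
          then have "f (Unlabeled (n div 2)) = f (Unlabeled (m div 2))"
            by (rule injD[OF inj_shift])
          then have "n div 2 = m div 2" using inj_onD[OF f(1) _ *] by simp
          then show ?thesis using True ev X Y by (metis dvd_div_eq_iff)
        next
          case False
          then show ?thesis using e ev X Y by (simp add: h_def)
        qed
      qed
    qed
  qed
  show ?thesis
  proof (rule isomorphicI[OF inj])
    show "preserves_labels h (fst (glue G H))" using lab by (auto simp: preserves_labels_def)
    show "map_graph h (glue G H) = glue G' H"
    proof -
      have m: "map_graph (h \<circ> shift 0) G = map_graph (shift 0 \<circ> f) G"
        by (rule map_graph_cong[OF assms(1) h0])
      show ?thesis unfolding map_glue h1 m by (simp add: glue_def f map_graph_comp)
    qed
  qed
qed

lemma glue_cong:
  assumes "multigraph G" "multigraph H" "isomorphic G G'" "isomorphic H H'"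
  shows "isomorphic (glue G H) (glue G' H')"
  by (meson assms glue_cong_left glue_commute isomorphic_trans)

lemma glue_empty: "isomorphic G (glue ({}, {#}) G)"
  by (rule isomorphicI[where f = "shift 1"])
    (auto simp: glue_def map_graph_def shift_preserves_labels intro: inj_on_subset[OF inj_shift])

text \<open>
  Isomorphism classes of graphs labeled by an arbitrary finite set of natural numbers. They form
  one commutative monoid under gluing, written additively so that \<open>lgraph \<Rightarrow>\<^sub>0 real\<close> is its
  monoid algebra; \<open>\<G>\<^sub>k\<close> is the subset of classes with label set \<open>{1..k}\<close>.
\<close>
quotient_type lgraph = pregraph /
  partial: "\<lambda>G H. multigraph G \<and> multigraph H \<and> isomorphic G H"
proof (rule part_equivpI)
  show "\<exists>G. multigraph G \<and> multigraph G \<and> isomorphic G G"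
    by (rule exI[of _ "({}, {#})"]) (simp add: multigraph_def isomorphic_refl)
qed (auto intro!: sympI transpI intro: isomorphic_sym isomorphic_trans)

instantiation lgraph :: comm_monoid_add
begin

lift_definition zero_lgraph :: lgraph is "({}, {#})"
  by (simp add: multigraph_def isomorphic_refl)

lift_definition plus_lgraph :: "lgraph \<Rightarrow> lgraph \<Rightarrow> lgraph" is glue
  by (simp add: multigraph_glue glue_cong)

instance
proof
  fix a b c :: lgraph
  show "a + b + c = a + (b + c)"
    by transfer (simp add: multigraph_glue glue_assoc)
  show "a + b = b + a"
    by transfer (simp add: multigraph_glue glue_commute)
  have "multigraph ({}, {#})" by (simp add: multigraph_def)
  then show "0 + a = a"
    by transfer (simp add: multigraph_glue isomorphic_sym[OF _ glue_empty])
qed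

end

lift_definition labels :: "lgraph \<Rightarrow> nat set" is "\<lambda>G. {i. Labeled i \<in> fst G}"
proof -
  fix G H assume "multigraph G \<and> multigraph H \<and> isomorphic G H"
  then obtain f where f: "preserves_labels f (fst G)" "fst H = f ` fst G"
    by (auto simp: isomorphic_def map_graph_def)
  have "Labeled i \<in> f ` fst G \<longleftrightarrow> Labeled i \<in> fst G" for i
  proof
    assume "Labeled i \<in> f ` fst G"
    then obtain v where "v \<in> fst G" "f v = Labeled i" by auto
    with f(1) show "Labeled i \<in> fst G" by (auto simp: preserves_labels_def)
  next
    assume "Labeled i \<in> fst G"
    with f(1) show "Labeled i \<in> f ` fst G" by (force simp: preserves_labels_def)
  qed
  with f(2) show "{i. Labeled i \<in> fst G} = {i. Labeled i \<in> fst H}" by simp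
qed

lift_definition fully_labeled :: "lgraph \<Rightarrow> bool" is "\<lambda>G. \<forall>v\<in>fst G. \<exists>i. v = Labeled i"
proof -
  fix G H assume "multigraph G \<and> multigraph H \<and> isomorphic G H"
  then obtain f where f: "preserves_labels f (fst G)" "fst H = f ` fst G"
    by (auto simp: isomorphic_def map_graph_def)
  have "(\<exists>i. f v = Labeled i) \<longleftrightarrow> (\<exists>i. v = Labeled i)" if "v \<in> fst G" for v
    using f(1) that by (simp add: preserves_labels_def)
  with f(2) show "(\<forall>v\<in>fst G. \<exists>i. v = Labeled i) = (\<forall>v\<in>fst H. \<exists>i. v = Labeled i)" by simp
qed

lift_definition unlabel :: "lgraph \<Rightarrow> lgraph" is "map_graph strip_label"
proof -
  fix G H assume *: "multigraph G \<and> multigraph H \<and> isomorphic G H"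
  then obtain f where f: "inj_on f (fst G)" "H = map_graph f G"
    by (auto simp: isomorphic_def)
  have ns: "strip_label v \<noteq> Labeled i" for v i by (cases v) auto
  let ?g = "strip_label \<circ> f \<circ> inv strip_label"
  have i: "inv strip_label (strip_label v) = v" for v by (simp add: inj_strip_label)
  have "isomorphic (map_graph strip_label G) (map_graph strip_label H)"
  proof (rule isomorphicI[where f = ?g])
    show "inj_on ?g (fst (map_graph strip_label G))"
      using f(1) inj_strip_label by (auto simp: inj_on_def map_graph_def i)
    show "preserves_labels ?g (fst (map_graph strip_label G))"
      using ns by (auto simp: preserves_labels_def map_graph_def)
    have "?g \<circ> strip_label = strip_label \<circ> f" using i by auto
    then show "map_graph ?g (map_graph strip_label G) = map_graph strip_label H"
      by (simp add: f map_graph_comp)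
  qed
  then show "multigraph (map_graph strip_label G) \<and> multigraph (map_graph strip_label H) \<and>
      isomorphic (map_graph strip_label G) (map_graph strip_label H)"
    using * by (simp add: multigraph_map inj_on_subset[OF inj_strip_label subset_UNIV])
qed

definition labeled_graphs :: "nat \<Rightarrow> lgraph set" where
  "labeled_graphs k = {G. labels G = {1..k}}"

lift_definition K1 :: lgraph is "({Unlabeled 0}, {#})"
  by (simp add: multigraph_def isomorphic_refl)

lift_definition K2 :: "nat \<Rightarrow> lgraph"
  is "\<lambda>j. ({Unlabeled 0, Unlabeled 1}, replicate_mset j {Unlabeled 0, Unlabeled 1})"
  by (simp add: multigraph_def isomorphic_refl)

definition graph_algebra :: "nat \<Rightarrow> (lgraph \<Rightarrow>\<^sub>0 real) set" where
  "graph_algebra k = {x. Poly_Mapping.keys x \<subseteq> labeled_graphs k}"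

definition flat_algebra :: "nat \<Rightarrow> (lgraph \<Rightarrow>\<^sub>0 real) set" where
  "flat_algebra k = {x. Poly_Mapping.keys x \<subseteq> {G \<in> labeled_graphs k. fully_labeled G}}"

abbreviation quantum_multigraphs :: "(lgraph \<Rightarrow>\<^sub>0 real) set" where
  "quantum_multigraphs \<equiv> graph_algebra 0"

abbreviation of_graph :: "lgraph \<Rightarrow> (lgraph \<Rightarrow>\<^sub>0 real)" where
  "of_graph G \<equiv> Poly_Mapping.single G 1"

text \<open>
  A graph parameter is a function on unlabeled graphs. It is represented by a function
  \<open>t :: lgraph \<Rightarrow> real\<close> of which only the values on \<open>labeled_graphs 0\<close> are ever used.
\<close>
definition extend :: "(lgraph \<Rightarrow> real) \<Rightarrow> (lgraph \<Rightarrow>\<^sub>0 real) \<Rightarrow> real" where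
  "extend t x = (\<Sum>G\<in>Poly_Mapping.keys x. Poly_Mapping.lookup x G * t (unlabel G))"

definition isolate_indifferent :: "(lgraph \<Rightarrow> real) \<Rightarrow> bool" where
  "isolate_indifferent t \<longleftrightarrow> (\<forall>G\<in>labeled_graphs 0. t (G + K1) = t G)"

definition flatly_reflection_positive :: "(lgraph \<Rightarrow> real) \<Rightarrow> bool" where
  "flatly_reflection_positive t \<longleftrightarrow> (\<forall>k. \<forall>b\<in>flat_algebra k. extend t (b\<^sup>2) \<ge> 0)"

definition bounded_parameter :: "real \<Rightarrow> (lgraph \<Rightarrow> real) \<Rightarrow> bool" where
  "bounded_parameter d t \<longleftrightarrow> (\<forall>k. \<bar>t (K2 k)\<bar> \<le> d ^ k)"

definition forget_labels :: "(lgraph \<Rightarrow>\<^sub>0 real) \<Rightarrow> (lgraph \<Rightarrow>\<^sub>0 real)" where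
  "forget_labels x =
     (\<Sum>G\<in>Poly_Mapping.keys x. Poly_Mapping.single (unlabel G) (Poly_Mapping.lookup x G))"

definition coincide :: "(lgraph \<Rightarrow>\<^sub>0 real) \<Rightarrow> (lgraph \<Rightarrow>\<^sub>0 real) \<Rightarrow> bool" where
  "coincide x y \<longleftrightarrow> forget_labels x - forget_labels y
     \<in> span {of_graph (G + K1) - of_graph G |G. G \<in> labeled_graphs 0}"

definition sums_of_squares :: "'a::semiring_1 set \<Rightarrow> 'a set" where
  "sums_of_squares A = {\<Sum>b\<leftarrow>bs. b\<^sup>2 |bs. set bs \<subseteq> A}"

end

theory Submission
  imports Defs "HOL-Analysis.Convex"
begin

text \<open>
  Let \<open>c\<^sub>j\<close> be the bundle of \<open>j\<close> parallel edges divided by \<open>d\<close> to the power \<open>j\<close>, let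
  \<open>u\<^sub>r = 1 + c\<^sub>2\<^sub>r\<close> be the perturbation in the theorem, let \<open>flat_cone r\<close> be the set of
  elements that coincide with a sum of squares of flat \<open>r\<close>-labeled elements, and call \<open>x\<close>
  approximable if for every \<open>\<epsilon> > 0\<close> some \<open>x + \<epsilon> u\<^sub>r\<close> lies in \<open>flat_cone r\<close>. The approximable
  elements form the set \<open>limit_cone d\<close>, and the theorem says that it is dual to the set of
  graph parameters in question.

  That these parameters are nonnegative on \<open>limit_cone d\<close> is immediate: they are nonnegative on
  every \<open>flat_cone r\<close>, and the value of \<open>u\<^sub>r\<close> is at most 2 (\<open>limit_cone_sound\<close>).

  Conversely, an element outside a convex cone is separated from it by a linear functional as
  soon as the cone has an order unit and the element stays outside after a small multiple of the
  unit is added (\<open>order_unit_separation\<close>, a Hahn-Banach argument). Here \<open>limit_cone d\<close> is a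
  convex cone that is closed along the direction of \<open>1\<close>, and \<open>1\<close> is an order unit
  (\<open>order_unit_one\<close>), although it is none for any single \<open>flat_cone r\<close>. The separating functional,
  restricted to graphs, is the required parameter: flat reflection positivity holds because
  squares are in the cone, isolate indifference because \<open>G + K\<^sub>1 - G\<close> and its negative are, and
  \<open>d\<close>-boundedness because \<open>1 \<plusminus> c\<^sub>k\<close> are (\<open>edges_bounded_by_one\<close>).

  All estimates come from one variable; let \<open>r \<ge> 2\<close>, so that there is one. A pair of labeled
  vertices joined by \<open>j\<close> edges is the \<open>j\<close>-th power of a single edge, so
  \<open>c\<^sub>2\<^sub>i - 2 c\<^sub>2\<^sub>i\<^sub>+\<^sub>2 + c\<^sub>2\<^sub>i\<^sub>+\<^sub>4\<close> coincides with a square and the sequence \<open>c\<^sub>2\<^sub>j\<close> is convex for the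
  order given by \<open>flat_cone r\<close>. A convex sequence lies below its chords, so
  \<open>c\<^sub>2\<^sub>k \<le> (1 - k/r) + (k/r) c\<^sub>2\<^sub>r\<close> for \<open>k \<le> r\<close> (\<open>even_edges_below_chord\<close>). Since \<open>k/r\<close> tends
  to 0, this gives \<open>1 - c\<^sub>2\<^sub>k \<in> limit_cone d\<close>; it also makes the perturbations comparable,
  \<open>u\<^sub>r \<le> 2 u\<^sub>s\<close> in \<open>flat_cone s\<close> for \<open>r \<le> s\<close> and \<open>s \<ge> 2\<close>, which is why approximable elements
  form a cone. Arbitrary graphs are, after labeling all vertices, products of edges and are
  bounded by repeated use of \<open>2xy \<le> x\<^sup>2 + y\<^sup>2\<close>. This works because, after forgetting labels and
  isolated vertices, powers of all the different variables become the same graphs, namely bundles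
  of parallel edges.
\<close>

section \<open>Separation from a convex cone with an order unit\<close>

lemma convex_cone_sum2:
  "convex_cone P \<Longrightarrow> x \<in> P \<Longrightarrow> y \<in> P \<Longrightarrow> 0 \<le> a \<Longrightarrow> 0 \<le> b \<Longrightarrow> a *\<^sub>R x + b *\<^sub>R y \<in> P"
  by (simp add: convex_cone_add convex_cone_scaleR)

text \<open>
  The order is \<open>x \<le> y \<longleftrightarrow> y - x \<in> P\<close>. The induction clears denominators and uses that the
  inequality for \<open>(k, n + 1)\<close> is a positive combination of the one for \<open>(k, n)\<close> and the one for
  \<open>(n, n + 1)\<close>.
\<close>
lemma convex_sequence_below_chord:
  fixes c :: "nat \<Rightarrow> 'a::real_vector"
  assumes P: "convex_cone P"
    and conv: "\<And>i. c i - 2 *\<^sub>R c (Suc i) + c (Suc (Suc i)) \<in> P"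
    and "k \<le> r" "0 < r"
  shows "(1 - k / r) *\<^sub>R c 0 + (k / r) *\<^sub>R c r - c k \<in> P"
proof -
  have e: "c 0 + real n *\<^sub>R c (Suc n) - real (Suc n) *\<^sub>R c n \<in> P" for n
  proof (induction n)
    case 0
    then show ?case using P by (simp add: convex_cone_contains_0)
  next
    case (Suc n)
    have "c 0 + real (Suc n) *\<^sub>R c (Suc (Suc n)) - real (Suc (Suc n)) *\<^sub>R c (Suc n)
      = (c 0 + real n *\<^sub>R c (Suc n) - real (Suc n) *\<^sub>R c n)
        + real (Suc n) *\<^sub>R (c n - 2 *\<^sub>R c (Suc n) + c (Suc (Suc n)))"
      by (simp add: algebra_simps scaleR_2)
    then show ?case using Suc conv P by (simp only: convex_cone_add convex_cone_scaleR of_nat_0_le_iff)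
  qed
  have "real (r - k) *\<^sub>R c 0 + real k *\<^sub>R c r - real r *\<^sub>R c k \<in> P"
    using \<open>k \<le> r\<close>
  proof (induction r rule: dec_induct)
    case base
    then show ?case using P by (simp add: convex_cone_contains_0)
  next
    case (step n)
    show ?case
    proof (cases "n = 0")
      case True
      then show ?thesis using step P by (simp add: convex_cone_contains_0)
    next
      case False
      have rk: "real (Suc n - k) = real n - real k + 1" "real (n - k) = real n - real k"
        using step by (auto simp: of_nat_diff)
      have "real n *\<^sub>R (real (Suc n - k) *\<^sub>R c 0 + real k *\<^sub>R c (Suc n) - real (Suc n) *\<^sub>R c k)
         = real (Suc n) *\<^sub>R (real (n - k) *\<^sub>R c 0 + real k *\<^sub>R c n - real n *\<^sub>R c k)
           + real k *\<^sub>R (c 0 + real n *\<^sub>R c (Suc n) - real (Suc n) *\<^sub>R c n)" (is "_ *\<^sub>R ?x = ?y")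
        unfolding rk by (simp add: algebra_simps)
      moreover have "?y \<in> P" using step.IH e P by (intro convex_cone_sum2) auto
      ultimately have "(1 / real n) *\<^sub>R (real n *\<^sub>R ?x) \<in> P"
        using P by (simp only:) (rule convex_cone_scaleR; simp)
      then show ?thesis using False by simp
    qed
  qed
  then have "(1 / real r) *\<^sub>R (real (r - k) *\<^sub>R c 0 + real k *\<^sub>R c r - real r *\<^sub>R c k) \<in> P"
    using P by (intro convex_cone_scaleR) auto
  then show ?thesis using assms
    by (simp add: scaleR_diff_right scaleR_add_right of_nat_diff diff_divide_distrib)
qed

lemma adjoin_convex_cone:
  fixes M :: "'a::real_vector set"
  assumes "convex_cone M"
  shows "convex_cone {m + c *\<^sub>R v |m c. m \<in> M \<and> 0 \<le> c}" (is "convex_cone ?N")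
  unfolding convex_cone_iff
proof (intro conjI ballI allI impI)
  show "0 \<in> ?N" using convex_cone_contains_0[OF assms] by force
next
  fix x y assume "x \<in> ?N" "y \<in> ?N"
  then obtain m c n b where "x = m + c *\<^sub>R v" "y = n + b *\<^sub>R v" "m \<in> M" "n \<in> M" "0 \<le> c" "0 \<le> b"
    by blast
  then show "x + y \<in> ?N"
    by (intro CollectI exI[of _ "m + n"] exI[of _ "c + b"]) (simp add: algebra_simps convex_cone_add[OF assms])
next
  fix x and b :: real assume "x \<in> ?N" "0 \<le> b"
  then obtain m c where "x = m + c *\<^sub>R v" "m \<in> M" "0 \<le> c" by blast
  with \<open>0 \<le> b\<close> show "b *\<^sub>R x \<in> ?N"
    by (intro CollectI exI[of _ "b *\<^sub>R m"] exI[of _ "b * c"]) (simp add: algebra_simps convex_cone_scaleR[OF assms])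
qed

text \<open>
  A maximal cone that avoids \<open>- e\<close> is total: if neither \<open>x\<close> nor \<open>- x\<close> could be adjoined, \<open>- e\<close>
  would be expressible with both, and a positive combination of the two expressions eliminates \<open>x\<close>.
\<close>
lemma extend_to_total_cone:
  fixes K :: "'a::real_vector set"
  assumes K: "convex_cone K" and e: "- e \<notin> K"
  obtains M where "convex_cone M" "K \<subseteq> M" "- e \<notin> M" "\<And>x. x \<in> M \<or> - x \<in> M"
proof -
  define A where "A = {M. convex_cone M \<and> K \<subseteq> M \<and> - e \<notin> M}"
  have "\<exists>M\<in>A. \<forall>X\<in>A. M \<subseteq> X \<longrightarrow> X = M"
  proof (rule subset_Zorn_nonempty)
    show "A \<noteq> {}" using assms by (auto simp: A_def)
    fix C assume C: "C \<noteq> {}" "subset.chain A C"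
    then have CA: "\<And>X. X \<in> C \<Longrightarrow> convex_cone X \<and> K \<subseteq> X \<and> - e \<notin> X"
      by (auto simp: A_def subset.chain_def)
    have "x + y \<in> \<Union>C" if "x \<in> \<Union>C" "y \<in> \<Union>C" for x y
    proof -
      from that obtain X Y where XY: "x \<in> X" "y \<in> Y" "X \<in> C" "Y \<in> C" by auto
      then have "X \<subseteq> Y \<or> Y \<subseteq> X" using C by (auto simp: subset_chain_def)
      then show ?thesis using XY CA convex_cone_add by blast
    qed
    moreover have "0 \<in> \<Union>C" using C CA convex_cone_contains_0 by blast
    moreover have "b *\<^sub>R x \<in> \<Union>C" if "x \<in> \<Union>C" "0 \<le> b" for x b
      using that CA convex_cone_scaleR by blast
    ultimately show "\<Union>C \<in> A"
      unfolding A_def convex_cone_iff using C CA by blast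
  qed
  then obtain M where "M \<in> A" and maxA: "\<And>X. X \<in> A \<Longrightarrow> M \<subseteq> X \<Longrightarrow> X = M"
    by blast
  then have M: "convex_cone M" "K \<subseteq> M" "- e \<notin> M"
    by (simp_all add: A_def)
  have max: "X = M" if "convex_cone X" "- e \<notin> X" "M \<subseteq> X" for X
    using that M by (intro maxA) (auto simp: A_def)
  have adj: "\<exists>m c. m \<in> M \<and> 0 < c \<and> - e = m + c *\<^sub>R v" if "v \<notin> M" for v
  proof -
    let ?N = "{m + c *\<^sub>R v |m c. m \<in> M \<and> 0 \<le> c}"
    have "M \<subseteq> ?N"
    proof
      fix x assume "x \<in> M"
      then show "x \<in> ?N" by (intro CollectI exI[of _ x] exI[of _ 0]) simp
    qed
    moreover have "v \<in> ?N"
      using convex_cone_contains_0[OF M(1)]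
      by (intro CollectI exI[of _ 0] exI[of _ 1]) simp
    ultimately have "- e \<in> ?N" using max[OF adjoin_convex_cone[OF M(1)], of v] that by blast
    then obtain m c where mc: "m \<in> M" "0 \<le> c" "- e = m + c *\<^sub>R v" by blast
    moreover have "c \<noteq> 0" using mc M(3) by auto
    ultimately show ?thesis by (metis less_eq_real_def)
  qed
  have "x \<in> M \<or> - x \<in> M" for x
  proof (rule ccontr)
    assume "\<not> ?thesis"
    then obtain m c n b where mn: "m \<in> M" "n \<in> M" "0 < c" "0 < b"
      and eq: "- e = m + c *\<^sub>R x" "- e = n + b *\<^sub>R (- x)"
      using adj[of x] adj[of "- x"] by blast
    \<comment> \<open>Eliminating \<open>x\<close> from the two expressions for \<open>- e\<close>.\<close>
    have "(b / (b + c)) *\<^sub>R m + (c / (b + c)) *\<^sub>R n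
       = (b / (b + c)) *\<^sub>R (- e - c *\<^sub>R x) + (c / (b + c)) *\<^sub>R (- e + b *\<^sub>R x)"
      using eq by (simp add: algebra_simps)
    also have "\<dots> = (b / (b + c) + c / (b + c)) *\<^sub>R (- e)"
      by (simp add: algebra_simps)
    also have "b / (b + c) + c / (b + c) = 1"
      using mn by (simp flip: add_divide_distrib)
    finally have "- e = (b / (b + c)) *\<^sub>R m + (c / (b + c)) *\<^sub>R n" by simp
    also have "\<dots> \<in> M" using mn M(1) by (intro convex_cone_sum2) auto
    finally show False using M(3) by simp
  qed
  with M that show ?thesis by blast
qed

text \<open>
  For a total cone the multiples of \<open>e\<close> below \<open>x\<close> and those above \<open>x\<close> form a Dedekind cut of the
  reals, and the functional sends \<open>x\<close> to the cut point. Since \<open>M\<close> need not be closed, the cut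
  point \<open>c\<close> is characterized up to an arbitrary \<open>\<delta> > 0\<close> on both sides; this determines it uniquely,
  and linearity follows from uniqueness.
\<close>
lemma total_cone_functional:
  fixes M :: "'a::real_vector set"
  assumes M: "convex_cone M" and e: "e \<in> M" "- e \<notin> M"
    and total: "\<And>x. x \<in> M \<or> - x \<in> M"
    and unit: "\<And>x. \<exists>N. N *\<^sub>R e - x \<in> M"
  obtains f :: "'a \<Rightarrow> real" where "linear f" "\<And>x. x \<in> M \<Longrightarrow> 0 \<le> f x" "f e = 1"
proof -
  define val where "val x c \<longleftrightarrow> (\<forall>\<delta>>0. x - (c - \<delta>) *\<^sub>R e \<in> M \<and> (c + \<delta>) *\<^sub>R e - x \<in> M)" for x c
  have halves: "\<delta> *\<^sub>R e = (\<delta>/2) *\<^sub>R e + (\<delta>/2) *\<^sub>R e" for \<delta>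
    by (metis scaleR_add_left field_sum_of_halves)
  have nonneg: "0 \<le> c" if "c *\<^sub>R e \<in> M" for c
  proof (rule ccontr)
    assume "\<not> 0 \<le> c"
    then have "(- (1 / c)) *\<^sub>R (c *\<^sub>R e) \<in> M"
      using \<open>\<not> 0 \<le> c\<close> by (intro convex_cone_scaleR[OF M _ that]) auto
    then show False using \<open>\<not> 0 \<le> c\<close> e by simp
  qed
  have val_le: "c \<le> b" if "val x c" "val x b" for x c b
  proof (rule field_le_epsilon)
    fix \<delta> :: real assume "0 < \<delta>"
    then have "x - (c - \<delta>/2) *\<^sub>R e \<in> M" "(b + \<delta>/2) *\<^sub>R e - x \<in> M"
      using that by (simp_all add: val_def)
    then have "(x - (c - \<delta>/2) *\<^sub>R e) + ((b + \<delta>/2) *\<^sub>R e - x) \<in> M" by (rule convex_cone_add[OF M])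
    also have "(x - (c - \<delta>/2) *\<^sub>R e) + ((b + \<delta>/2) *\<^sub>R e - x) = (b + \<delta>/2 - (c - \<delta>/2)) *\<^sub>R e"
      by (simp only: scaleR_diff_left) simp
    finally have "0 \<le> b + \<delta>/2 - (c - \<delta>/2)" by (rule nonneg)
    then show "c \<le> b + \<delta>" by simp
  qed
  have val_ex: "\<exists>c. val x c" for x
  proof -
    define S where "S = {c. x - c *\<^sub>R e \<in> M}"
    obtain N N' where N: "N *\<^sub>R e - x \<in> M" and N': "N' *\<^sub>R e - (- x) \<in> M"
      using unit by blast
    have "- N' \<in> S" using N' by (simp add: S_def algebra_simps)
    have le: "c \<le> b" if "c \<in> S" "b *\<^sub>R e - x \<in> M" for c b
    proof -
      have "(x - c *\<^sub>R e) + (b *\<^sub>R e - x) \<in> M"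
        using that by (intro convex_cone_add[OF M]) (auto simp: S_def)
      also have "(x - c *\<^sub>R e) + (b *\<^sub>R e - x) = (b - c) *\<^sub>R e" by (simp add: algebra_simps)
      finally show ?thesis using nonneg by fastforce
    qed
    then have bdd: "bdd_above S" using N by (intro bdd_aboveI[of _ N]) auto
    have "val x (Sup S)" unfolding val_def
    proof (intro allI impI conjI)
      fix \<delta> :: real assume "0 < \<delta>"
      then obtain s where s: "s \<in> S" "Sup S - \<delta> < s"
        using less_cSup_iff[OF _ bdd, of "Sup S - \<delta>"] \<open>- N' \<in> S\<close> by auto
      have "(x - s *\<^sub>R e) + (s - (Sup S - \<delta>)) *\<^sub>R e \<in> M"
        using s e by (intro convex_cone_add[OF M] convex_cone_scaleR[OF M]) (auto simp: S_def)
      then show "x - (Sup S - \<delta>) *\<^sub>R e \<in> M" by (simp add: algebra_simps)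
      have "Sup S + \<delta> \<notin> S" using cSup_upper[OF _ bdd, of "Sup S + \<delta>"] \<open>0 < \<delta>\<close> by auto
      then have "x - (Sup S + \<delta>) *\<^sub>R e \<notin> M" by (simp add: S_def)
      then show "(Sup S + \<delta>) *\<^sub>R e - x \<in> M" using total[of "x - (Sup S + \<delta>) *\<^sub>R e"] by simp
    qed
    then show ?thesis by blast
  qed
  define f where "f x = (SOME c. val x c)" for x
  have f: "val x (f x)" for x unfolding f_def by (rule someI_ex[OF val_ex])
  have feq: "f x = c" if "val x c" for x c
    using val_le[OF f that] val_le[OF that f] by simp
  have val_add: "val (x + y) (c + b)" if "val x c" "val y b" for x y c b
    unfolding val_def
  proof (intro allI impI conjI)
    fix \<delta> :: real assume "0 < \<delta>"
    then have *: "x - (c - \<delta>/2) *\<^sub>R e \<in> M" "(c + \<delta>/2) *\<^sub>R e - x \<in> M"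
        "y - (b - \<delta>/2) *\<^sub>R e \<in> M" "(b + \<delta>/2) *\<^sub>R e - y \<in> M"
      using that by (simp_all add: val_def)
    show "x + y - (c + b - \<delta>) *\<^sub>R e \<in> M"
      using convex_cone_add[OF M *(1,3)] by (simp add: algebra_simps halves[of \<delta>])
    show "(c + b + \<delta>) *\<^sub>R e - (x + y) \<in> M"
      using convex_cone_add[OF M *(2,4)] by (simp add: algebra_simps halves[of \<delta>])
  qed
  have val_uminus: "val (- x) (- c)" if "val x c" for x c
    using that by (auto simp: val_def algebra_simps)
  have val_pos: "val (b *\<^sub>R x) (b * c)" if "val x c" "0 < b" for x c b
    unfolding val_def
  proof (intro allI impI conjI)
    fix \<delta> :: real assume "0 < \<delta>"
    then have *: "x - (c - \<delta>/b) *\<^sub>R e \<in> M" "(c + \<delta>/b) *\<^sub>R e - x \<in> M"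
      using that by (simp_all add: val_def)
    show "b *\<^sub>R x - (b * c - \<delta>) *\<^sub>R e \<in> M"
      using convex_cone_scaleR[OF M _ *(1), of b] that(2) by (simp add: algebra_simps)
    show "(b * c + \<delta>) *\<^sub>R e - b *\<^sub>R x \<in> M"
      using convex_cone_scaleR[OF M _ *(2), of b] that(2) by (simp add: algebra_simps)
  qed
  have val_0: "val 0 0" using e M by (auto simp: val_def intro: convex_cone_scaleR)
  have val_scale: "val (b *\<^sub>R x) (b * c)" if "val x c" for x c b
  proof -
    consider "b = 0" | "0 < b" | "0 < - b" by linarith
    then show ?thesis
    proof cases
      case 1
      then show ?thesis using val_0 by simp
    next
      case 2
      then show ?thesis using val_pos that by blast
    next
      case 3
      then show ?thesis using val_uminus[OF val_pos[OF that 3]] by simp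
    qed
  qed
  have "linear f"
    by (rule linearI) (use feq[OF val_add[OF f f]] feq[OF val_scale[OF f]] in simp_all)
  moreover have "0 \<le> f x" if "x \<in> M" for x
  proof (rule field_le_epsilon)
    fix \<delta> :: real assume "0 < \<delta>"
    then have "(f x + \<delta>) *\<^sub>R e - x \<in> M" using f by (simp add: val_def)
    from convex_cone_add[OF M this that] show "0 \<le> f x + \<delta>" using nonneg by simp
  qed
  moreover have "f e = 1"
  proof (rule feq)
    have "e - (1 - \<delta>) *\<^sub>R e = \<delta> *\<^sub>R e" "(1 + \<delta>) *\<^sub>R e - e = \<delta> *\<^sub>R e" for \<delta>
      by (simp_all add: algebra_simps)
    then show "val e 1" using e M by (auto simp: val_def intro: convex_cone_scaleR)
  qed
  ultimately show ?thesis using that by blast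
qed

text \<open>
  The cone generated by \<open>K\<close> and \<open>- (a + \<epsilon> e)\<close> still avoids \<open>- e\<close>, so a total cone above it yields
  a functional with \<open>f a \<le> - \<epsilon>\<close>.
\<close>
theorem order_unit_separation:
  fixes K :: "'a::real_vector set"
  assumes K: "convex_cone K" and e: "e \<in> K"
    and unit: "\<And>x. \<exists>N. N *\<^sub>R e - x \<in> K"
    and a: "a + \<epsilon> *\<^sub>R e \<notin> K" "0 < \<epsilon>"
  obtains f :: "'a \<Rightarrow> real" where "linear f" "\<And>x. x \<in> K \<Longrightarrow> 0 \<le> f x" "f e = 1" "f a < 0"
proof -
  let ?v = "- (a + \<epsilon> *\<^sub>R e)"
  let ?N = "{m + c *\<^sub>R ?v |m c. m \<in> K \<and> 0 \<le> c}"
  have N: "convex_cone ?N" by (rule adjoin_convex_cone[OF K])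
  have KN: "K \<subseteq> ?N"
  proof
    fix x assume "x \<in> K"
    then show "x \<in> ?N" by (intro CollectI exI[of _ x] exI[of _ 0]) simp
  qed
  have vN: "?v \<in> ?N"
    using convex_cone_contains_0[OF K] by (intro CollectI exI[of _ 0] exI[of _ 1]) simp
  have neK: "- e \<notin> K"
  proof
    assume ne: "- e \<in> K"
    obtain n where n: "n *\<^sub>R e - (- (a + \<epsilon> *\<^sub>R e)) \<in> K" using unit by blast
    have "\<bar>n\<bar> *\<^sub>R (- e) + (\<bar>n\<bar> - n) *\<^sub>R e \<in> K"
      using K e ne by (intro convex_cone_sum2) auto
    from convex_cone_add[OF K n this] show False using a by (simp add: algebra_simps)
  qed
  have "- e \<notin> ?N"
  proof
    assume "- e \<in> ?N"
    then obtain m c where mc: "m \<in> K" "0 \<le> c" "- e = m + c *\<^sub>R ?v" by blast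
    then have "c \<noteq> 0" using neK by auto
    have eq: "m + e = c *\<^sub>R (a + \<epsilon> *\<^sub>R e)" using mc(3) by (simp add: algebra_simps eq_neg_iff_add_eq_0)
    have "(1 / c) *\<^sub>R (m + e) \<in> K"
      using mc e by (intro convex_cone_scaleR[OF K] convex_cone_add[OF K]) auto
    then show False using a \<open>c \<noteq> 0\<close> unfolding eq by simp
  qed
  then obtain M where M: "convex_cone M" "?N \<subseteq> M" "- e \<notin> M" "\<And>x. x \<in> M \<or> - x \<in> M"
    using extend_to_total_cone[OF N] by blast
  have eM: "e \<in> M" using e KN M(2) by blast
  have unitM: "\<exists>N. N *\<^sub>R e - x \<in> M" for x using unit[of x] KN M(2) by blast
  obtain f :: "'a \<Rightarrow> real" where f: "linear f" "\<And>x. x \<in> M \<Longrightarrow> 0 \<le> f x" "f e = 1"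
    using total_cone_functional[OF M(1) eM M(3,4) unitM] by blast
  have "0 \<le> f ?v" using f(2) vN M(2) by blast
  then have "f a + \<epsilon> \<le> 0" using f(1,3) by (simp add: linear_neg linear_diff linear_add linear_cmul)
  then have "f a < 0" using a(2) by simp
  then show ?thesis using that f KN M(2) by blast
qed

section \<open>Flat graphs\<close>

text \<open>
  All isomorphisms between concrete graphs below are instances: both graphs are presented as
  injective images of a common one.
\<close>
lemma isomorphic_maps:
  assumes "multigraph H" "inj_on g (fst H)" "inj_on h (fst H)"
    and lab: "\<And>v i. v \<in> fst H \<Longrightarrow> g v = Labeled i \<longleftrightarrow> h v = Labeled i"
  shows "isomorphic (map_graph g H) (map_graph h H)"
proof -
  let ?f = "h \<circ> inv_into (fst H) g"
  have inv: "inv_into (fst H) g (g v) = v" if "v \<in> fst H" for v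
    using assms(2) that by simp
  show ?thesis
  proof (rule isomorphicI[where f = ?f])
    show "inj_on ?f (fst (map_graph g H))"
      using assms(3) inv by (auto simp: map_graph_def inj_on_def)
    show "preserves_labels ?f (fst (map_graph g H))"
      using lab inv by (auto simp: map_graph_def preserves_labels_def)
    show "map_graph ?f (map_graph g H) = map_graph h H"
      unfolding map_graph_comp using inv by (intro map_graph_cong[OF assms(1)]) simp
  qed
qed

lemma multigraph_isomorphic: "multigraph G \<Longrightarrow> isomorphic G H \<Longrightarrow> multigraph H"
  by (auto simp: isomorphic_def intro: multigraph_map)

lemma abs_lgraph_eqI: "multigraph G \<Longrightarrow> isomorphic G H \<Longrightarrow> abs_lgraph G = abs_lgraph H"
  by (rule Quotient_rel_abs[OF Quotient_lgraph]) (simp add: multigraph_isomorphic)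

lemma lgraph_cases:
  obtains H where "multigraph H" "G = abs_lgraph H"
  by (induction G rule: lgraph.abs_induct) auto

lemma abs_lgraph_add: "multigraph G \<Longrightarrow> multigraph H \<Longrightarrow> abs_lgraph G + abs_lgraph H = abs_lgraph (glue G H)"
  by (simp add: plus_lgraph.abs_eq isomorphic_refl)

lemma labels_abs_lgraph: "multigraph G \<Longrightarrow> labels (abs_lgraph G) = {i. Labeled i \<in> fst G}"
  by (simp add: labels.abs_eq isomorphic_refl)

lemma fully_labeled_abs_lgraph:
  "multigraph G \<Longrightarrow> fully_labeled (abs_lgraph G) \<longleftrightarrow> (\<forall>v\<in>fst G. \<exists>i. v = Labeled i)"
  by (simp add: fully_labeled.abs_eq isomorphic_refl)

lemma unlabel_abs_lgraph: "multigraph G \<Longrightarrow> unlabel (abs_lgraph G) = abs_lgraph (map_graph strip_label G)"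
  by (simp add: unlabel.abs_eq isomorphic_refl)

lemma inj_on_strip_label: "inj_on strip_label V"
  by (rule inj_on_subset[OF inj_strip_label subset_UNIV])

lemma inj_on_shift: "inj_on (shift c) V"
  by (rule inj_on_subset[OF inj_shift subset_UNIV])

lemma multigraph_strip_label: "multigraph G \<Longrightarrow> multigraph (map_graph strip_label G)"
  by (simp add: multigraph_map inj_on_strip_label)

lemma shift_eq_Labeled [simp]: "shift c v = Labeled i \<longleftrightarrow> v = Labeled i"
    "Labeled i = shift c v \<longleftrightarrow> v = Labeled i"
  by (cases v; auto)+

lemma strip_label_neq_Labeled [simp]: "strip_label v \<noteq> Labeled i" "Labeled i \<noteq> strip_label v"
  by (cases v; simp)+

lemma fst_map_graph [simp]: "fst (map_graph f G) = f ` fst G"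
  by (simp add: map_graph_def)

lemma fst_glue [simp]: "fst (glue G H) = shift 0 ` fst G \<union> shift 1 ` fst H"
  by (simp add: glue_def)

lemma labels_add: "labels (G + H) = labels G \<union> labels H"
proof -
  obtain G' H' where GH: "multigraph G'" "G = abs_lgraph G'" "multigraph H'" "H = abs_lgraph H'"
    by (meson lgraph_cases)
  then show ?thesis
    by (auto simp: abs_lgraph_add labels_abs_lgraph multigraph_glue image_iff)
qed

lemma fully_labeled_add: "fully_labeled G \<Longrightarrow> fully_labeled H \<Longrightarrow> fully_labeled (G + H)"
proof -
  obtain G' H' where GH: "multigraph G'" "G = abs_lgraph G'" "multigraph H'" "H = abs_lgraph H'"
    by (meson lgraph_cases)
  moreover assume "fully_labeled G" "fully_labeled H"
  ultimately show "fully_labeled (G + H)"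
    by (fastforce simp: abs_lgraph_add fully_labeled_abs_lgraph multigraph_glue)
qed

lemma labels_unlabel [simp]: "labels (unlabel G) = {}"
  by (rule lgraph_cases[of G])
    (auto simp: unlabel_abs_lgraph labels_abs_lgraph multigraph_strip_label image_iff)

lemma unlabel_eq_self:
  assumes "labels G = {}"
  shows "unlabel G = G"
proof -
  obtain H where H: "multigraph H" "G = abs_lgraph H" by (rule lgraph_cases)
  with assms have "isomorphic (map_graph strip_label H) (map_graph id H)"
    by (intro isomorphic_maps) (auto simp: inj_on_strip_label labels_abs_lgraph)
  then have "abs_lgraph (map_graph strip_label H) = abs_lgraph (map_graph id H)"
    using H by (intro abs_lgraph_eqI multigraph_strip_label)
  also have "map_graph id H = H" by (simp add: map_graph_def)
  finally show ?thesis using H by (simp add: unlabel_abs_lgraph)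
qed

lemma unlabel_unlabel [simp]: "unlabel (unlabel G) = unlabel G"
  by (simp add: unlabel_eq_self)

lemma labels_zero [simp]: "labels 0 = {}"
  by (simp add: zero_lgraph_def labels_abs_lgraph multigraph_def)

lemma labels_K1 [simp]: "labels K1 = {}"
  by (simp add: K1_def labels_abs_lgraph multigraph_def)

lemma labels_K2 [simp]: "labels (K2 j) = {}"
  by (simp add: K2_def labels_abs_lgraph multigraph_def)

lemma K2_0: "K2 0 = K1 + K1"
proof -
  have K: "multigraph ({Unlabeled 0}, {#})" by (simp add: multigraph_def)
  have "glue ({Unlabeled 0}, {#}) ({Unlabeled 0}, {#}) = ({Unlabeled 0, Unlabeled 1}, {#})"
    by (auto simp: glue_def map_graph_def)
  then show ?thesis by (simp add: K1_def K2_def abs_lgraph_add[OF K K])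
qed

definition edges_on :: "nat set \<Rightarrow> nat set multiset \<Rightarrow> bool" where
  "edges_on S M \<longleftrightarrow> finite S \<and> (\<forall>e\<in>#M. e \<subseteq> S \<and> card e = 2)"

text \<open>
  Loopless multigraphs whose vertices all carry labels, with vertices and edges given by natural
  numbers. They multiply by uniting vertex sets and adding edge multisets, without any renaming.
\<close>
definition flat_graph :: "nat set \<Rightarrow> nat set multiset \<Rightarrow> lgraph" where
  "flat_graph S M = abs_lgraph (Labeled ` S, image_mset ((`) Labeled) M)"

lemma edges_on_empty [simp]: "edges_on S {#} \<longleftrightarrow> finite S"
  by (simp add: edges_on_def)

lemma edges_on_repeat: "edges_on S M \<Longrightarrow> edges_on S (repeat_mset n M)"
  by (induction n) (auto simp: edges_on_def)

lemma inj_on_Labeled: "inj_on Labeled S"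
  by (simp add: inj_on_def)

lemma multigraph_flat: "edges_on S M \<Longrightarrow> multigraph (Labeled ` S, image_mset ((`) Labeled) M)"
  by (auto simp: edges_on_def multigraph_def card_image inj_on_Labeled)

lemma labels_flat_graph: "edges_on S M \<Longrightarrow> labels (flat_graph S M) = S"
  by (auto simp: flat_graph_def labels_abs_lgraph multigraph_flat)

lemma fully_labeled_flat_graph: "edges_on S M \<Longrightarrow> fully_labeled (flat_graph S M)"
  by (auto simp: flat_graph_def fully_labeled_abs_lgraph multigraph_flat)

lemma map_graph_shift_flat:
  "map_graph (shift c) (Labeled ` S, image_mset ((`) Labeled) M) = (Labeled ` S, image_mset ((`) Labeled) M)"
  by (simp add: map_graph_def image_image multiset.map_comp o_def)

lemma flat_graph_add:
  "edges_on S M \<Longrightarrow> edges_on T N \<Longrightarrow> flat_graph S M + flat_graph T N = flat_graph (S \<union> T) (M + N)"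
  by (simp add: flat_graph_def abs_lgraph_add multigraph_flat glue_def map_graph_shift_flat image_Un)

text \<open>
  Any numbering of the vertices provides the labels.
\<close>
lemma unlabel_eq_unlabel_flat_graph:
  obtains k M where "edges_on {1..k} M" "unlabel G = unlabel (flat_graph {1..k} M)"
proof -
  obtain V E where H: "multigraph (V, E)" and G: "G = abs_lgraph (V, E)"
    by (metis lgraph_cases surj_pair)
  then obtain f where f: "bij_betw f V {1..card V}"
    using ex_bij_betw_finite_nat[of V] ex_bij_betw_nat_finite_1[of V] bij_betw_inv
    by (metis fst_conv multigraph_def)
  have inj: "inj_on f V" and im: "f ` V = {1..card V}" using f by (auto simp: bij_betw_def)
  let ?M = "image_mset ((`) f) E"
  have "edges_on {1..card V} ?M"
    unfolding edges_on_def
  proof (intro conjI ballI)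
    fix e assume "e \<in># ?M"
    then obtain e' where "e = f ` e'" "e' \<subseteq> V" "card e' = 2"
      using H by (auto simp: multigraph_def)
    then show "e \<subseteq> {1..card V}" "card e = 2"
      using im inj by (auto simp: card_image inj_on_subset)
  qed simp
  moreover have flat: "(Labeled ` {1..card V}, image_mset ((`) Labeled) ?M) = map_graph (Labeled \<circ> f) (V, E)"
    unfolding im[symmetric] by (simp add: map_graph_def multiset.map_comp o_def image_image)
  have "unlabel G = unlabel (flat_graph {1..card V} ?M)"
  proof -
    have "isomorphic (map_graph strip_label (V, E)) (map_graph (strip_label \<circ> (Labeled \<circ> f)) (V, E))"
      using H inj by (intro isomorphic_maps comp_inj_on inj_on_strip_label inj_on_Labeled) auto
    then show ?thesis
      using H multigraph_flat[OF \<open>edges_on _ ?M\<close>]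
      unfolding G flat_graph_def flat
      by (simp add: unlabel_abs_lgraph map_graph_comp abs_lgraph_eqI multigraph_strip_label)
  qed
  ultimately show ?thesis using that by blast
qed

lemma add_present_vertex:
  assumes "i \<in> labels G"
  shows "G + flat_graph {i} {#} = G"
proof -
  obtain H where H: "multigraph H" "G = abs_lgraph H" by (rule lgraph_cases)
  have i: "Labeled i \<in> fst H" using assms H by (simp add: labels_abs_lgraph)
  then have gl: "glue H (Labeled ` {i}, image_mset ((`) Labeled) {#}) = map_graph (shift 0) H"
    by (force simp: glue_def map_graph_def)
  have "isomorphic H (map_graph (shift 0) H)"
    by (rule isomorphicI[OF inj_on_shift shift_preserves_labels refl])
  then have "abs_lgraph H = abs_lgraph (map_graph (shift 0) H)"
    using H by (intro abs_lgraph_eqI)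
  moreover have "G + flat_graph {i} {#} = abs_lgraph (map_graph (shift 0) H)"
    using H multigraph_flat[of "{i}" "{#}"] unfolding flat_graph_def gl[symmetric]
    by (simp only: abs_lgraph_add edges_on_empty finite.intros)
  ultimately show ?thesis using H by simp
qed

text \<open>
  Both sides are images of the graph \<open>(insert (Labeled i) V, E)\<close>, under maps that differ in how they
  rename the unlabeled vertices.
\<close>
lemma unlabel_add_new_vertex:
  assumes "i \<notin> labels G"
  shows "unlabel (G + flat_graph {i} {#}) = unlabel G + K1"
proof -
  obtain V E where H: "multigraph (V, E)" "G = abs_lgraph (V, E)"
    by (metis lgraph_cases surj_pair)
  have i: "Labeled i \<notin> V" using assms H by (simp add: labels_abs_lgraph)
  let ?H = "(insert (Labeled i) V, E)"
  let ?h = "\<lambda>v. if v = Labeled i then Unlabeled 1 else shift 0 (strip_label v)"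
  have mH: "multigraph ?H" using H by (auto simp: multigraph_def)
  have m1: "multigraph ({Labeled i}, {#})" and mK: "multigraph ({Unlabeled 0}, {#})"
    by (auto simp: multigraph_def)
  have "unlabel (G + flat_graph {i} {#}) = abs_lgraph (map_graph strip_label (glue (V, E) ({Labeled i}, {#})))"
    using H m1 by (simp add: flat_graph_def abs_lgraph_add unlabel_abs_lgraph multigraph_glue)
  also have "map_graph strip_label (glue (V, E) ({Labeled i}, {#})) = map_graph (strip_label \<circ> shift 0) ?H"
    by (simp add: map_glue) (simp add: map_graph_def)
  also have "abs_lgraph \<dots> = abs_lgraph (map_graph ?h ?H)"
  proof (rule abs_lgraph_eqI)
    have inj: "inj_on (strip_label \<circ> shift 0) W" for W
      by (intro comp_inj_on inj_on_shift inj_on_strip_label)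
    then show "multigraph (map_graph (strip_label \<circ> shift 0) ?H)" using mH by (intro multigraph_map)
    have ne: "Unlabeled 1 \<noteq> shift 0 (strip_label v)" for v by (cases "strip_label v") auto
    have inj_h: "inj_on ?h W" for W
    proof (rule inj_onI)
      fix v w assume "?h v = ?h w"
      then show "v = w"
        using ne[of v] ne[of w] by (auto split: if_splits dest: injD[OF inj_shift] injD[OF inj_strip_label])
    qed
    show "isomorphic (map_graph (strip_label \<circ> shift 0) ?H) (map_graph ?h ?H)"
      by (rule isomorphic_maps[OF mH inj inj_h]) simp
  qed
  also have "map_graph ?h ?H = glue (map_graph strip_label (V, E)) ({Unlabeled 0}, {#})"
  proof -
    have "map_graph ?h (V, E) = map_graph (shift 0 \<circ> strip_label) (V, E)"
      using i by (intro map_graph_cong[OF H(1)]) auto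
    then have "?h ` V = (shift 0 \<circ> strip_label) ` V"
      and "image_mset ((`) ?h) E = image_mset ((`) (shift 0 \<circ> strip_label)) E"
      by (simp_all only: map_graph_def prod.inject fst_conv snd_conv)
    moreover have "?h (Labeled i) = Unlabeled 1" by simp
    ultimately have "map_graph ?h ?H = (insert (Unlabeled 1) ((shift 0 \<circ> strip_label) ` V),
        image_mset ((`) (shift 0 \<circ> strip_label)) E)"
      by (simp only: map_graph_def fst_conv snd_conv image_insert)
    also have "\<dots> = glue (map_graph strip_label (V, E)) ({Unlabeled 0}, {#})"
      by (simp add: glue_def map_graph_comp) (simp add: map_graph_def)
    finally show ?thesis .
  qed
  also have "abs_lgraph \<dots> = unlabel G + K1"
    using H mK by (simp add: K1_def unlabel_abs_lgraph abs_lgraph_add multigraph_strip_label)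
  finally show ?thesis .
qed

lemma edges_on_replicate: "finite S \<Longrightarrow> e \<subseteq> S \<Longrightarrow> card e = 2 \<Longrightarrow> edges_on S (replicate_mset j e)"
  by (auto simp: edges_on_def)

lemma unlabel_parallel_edges:
  assumes "card e = 2"
  shows "unlabel (flat_graph e (replicate_mset j e)) = K2 j"
proof -
  obtain a b where e: "e = {a, b}" "a \<noteq> b" using assms by (auto simp: card_2_iff)
  let ?P = "({Unlabeled 0, Unlabeled 1}, replicate_mset j {Unlabeled 0, Unlabeled 1})"
  let ?F = "(Labeled ` e, image_mset ((`) Labeled) (replicate_mset j e))"
  \<comment> \<open>Forgetting labels sends \<open>Labeled a\<close> to \<open>Unlabeled (2 * a)\<close>.\<close>
  let ?g = "\<lambda>v. if v = Unlabeled 0 then Unlabeled (2 * a) else Unlabeled (2 * b)"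
  have P: "multigraph ?P" by (simp add: multigraph_def)
  have F: "multigraph ?F" using e by (intro multigraph_flat edges_on_replicate assms) auto
  have eq: "map_graph ?g ?P = map_graph strip_label ?F"
    unfolding e by (simp add: map_graph_def insert_commute[of "Unlabeled (2 * b)"])
  have "isomorphic (map_graph ?g ?P) (map_graph id ?P)"
    using e(2) by (intro isomorphic_maps P) auto
  then have "abs_lgraph (map_graph strip_label ?F) = abs_lgraph (map_graph id ?P)"
    using F unfolding eq by (intro abs_lgraph_eqI multigraph_strip_label)
  then show ?thesis
    unfolding flat_graph_def unlabel_abs_lgraph[OF F] by (simp add: K2_def map_graph_def)
qed

section \<open>The monoid algebra and its negligible elements\<close>

lemma lookup_scaleR [simp]:
  fixes x :: "'a \<Rightarrow>\<^sub>0 real"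
  shows "Poly_Mapping.lookup (c *\<^sub>R x) k = c * Poly_Mapping.lookup x k"
proof -
  have "finite {k. c * Poly_Mapping.lookup x k \<noteq> 0}"
    by (rule finite_subset[of _ "Poly_Mapping.keys x"]) (auto simp: in_keys_iff)
  then show ?thesis by (simp add: scaleR_poly_mapping_def)
qed

lemma scaleR_conv_mult: "c *\<^sub>R x = Poly_Mapping.single 0 c * (x :: lgraph \<Rightarrow>\<^sub>0 real)"
  unfolding mult_map_scale_conv_mult[symmetric]
  by (rule poly_mapping_eqI) (simp add: Poly_Mapping.map.rep_eq when_def)

lemma scaleR_of_graph: "c *\<^sub>R of_graph G = Poly_Mapping.single G c"
  by (simp add: scaleR_conv_mult mult_single)

lemma scaleR_mult: "(c *\<^sub>R x) * (b *\<^sub>R y) = (c * b) *\<^sub>R (x * (y :: lgraph \<Rightarrow>\<^sub>0 real))"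
proof -
  have "Poly_Mapping.single (0::lgraph) (c * b) = Poly_Mapping.single 0 c * Poly_Mapping.single 0 b"
    by (simp add: mult_single)
  then show ?thesis by (simp add: scaleR_conv_mult mult_ac)
qed

lemma square_add_scaleR:
  fixes x y :: "lgraph \<Rightarrow>\<^sub>0 real"
  shows "(x + c *\<^sub>R y)\<^sup>2 = x\<^sup>2 + (2 * c) *\<^sub>R (x * y) + c\<^sup>2 *\<^sub>R y\<^sup>2"
proof -
  have xy: "x * (c *\<^sub>R y) = c *\<^sub>R (x * y)"
    using scaleR_mult[of 1 x c y] by simp
  have "(x + c *\<^sub>R y)\<^sup>2 = x\<^sup>2 + (c *\<^sub>R y)\<^sup>2 + 2 * (x * (c *\<^sub>R y))"
    by (simp only: power2_sum mult.assoc)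
  also have "2 * (x * (c *\<^sub>R y)) = (2 * c) *\<^sub>R (x * y)"
    unfolding xy mult_2 by (simp only: scaleR_left_distrib)
  also have "(c *\<^sub>R y)\<^sup>2 = c\<^sup>2 *\<^sub>R y\<^sup>2"
    by (simp only: power2_eq_square scaleR_mult)
  finally show ?thesis by (simp only: add_ac)
qed

lemma graph_expansion:
  "(\<Sum>G\<in>Poly_Mapping.keys x. Poly_Mapping.lookup x G *\<^sub>R of_graph G) = x"
  by (rule poly_mapping_eqI)
    (simp add: lookup_sum lookup_single when_def in_keys_iff if_distrib[of "(*) _"] cong: if_cong)

text \<open>
  Graphs form a basis, so identities between linear maps are checked on graphs.
\<close>
lemma linear_eq_on_graphs:
  assumes "linear f" "linear g" "\<And>G. f (of_graph G) = g (of_graph G)"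
  shows "f x = g x"
proof -
  have "f (\<Sum>G\<in>Poly_Mapping.keys x. Poly_Mapping.lookup x G *\<^sub>R of_graph G)
      = g (\<Sum>G\<in>Poly_Mapping.keys x. Poly_Mapping.lookup x G *\<^sub>R of_graph G)"
    using assms by (simp add: linear_sum linear_cmul)
  then show ?thesis by (simp only: graph_expansion)
qed

lemma linear_extend_graphs:
  fixes h :: "lgraph \<Rightarrow> 'b::real_vector"
  shows "linear (\<lambda>x :: lgraph \<Rightarrow>\<^sub>0 real. \<Sum>G\<in>Poly_Mapping.keys x. Poly_Mapping.lookup x G *\<^sub>R h G)"
proof -
  let ?f = "\<lambda>x :: lgraph \<Rightarrow>\<^sub>0 real. \<Sum>G\<in>Poly_Mapping.keys x. Poly_Mapping.lookup x G *\<^sub>R h G"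
  have *: "?f x = (\<Sum>G\<in>S. Poly_Mapping.lookup x G *\<^sub>R h G)"
    if "finite S" "Poly_Mapping.keys x \<subseteq> S" for x S
    using that by (intro sum.mono_neutral_left) (auto simp: in_keys_iff)
  show ?thesis
  proof (rule linearI)
    fix x y :: "lgraph \<Rightarrow>\<^sub>0 real"
    let ?S = "Poly_Mapping.keys x \<union> Poly_Mapping.keys y"
    have "?f x + ?f y = (\<Sum>G\<in>?S. Poly_Mapping.lookup x G *\<^sub>R h G) + (\<Sum>G\<in>?S. Poly_Mapping.lookup y G *\<^sub>R h G)"
      using *[of ?S x] *[of ?S y] by simp
    also have "\<dots> = (\<Sum>G\<in>?S. Poly_Mapping.lookup (x + y) G *\<^sub>R h G)"
      by (simp add: lookup_add scaleR_add_left sum.distrib)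
    also have "\<dots> = ?f (x + y)"
      using keys_add[of x y] by (intro *[symmetric]) auto
    finally show "?f (x + y) = ?f x + ?f y" ..
  next
    fix c and x :: "lgraph \<Rightarrow>\<^sub>0 real"
    have "?f (c *\<^sub>R x) = (\<Sum>G\<in>Poly_Mapping.keys x. Poly_Mapping.lookup (c *\<^sub>R x) G *\<^sub>R h G)"
      by (rule *) (auto simp: in_keys_iff)
    then show "?f (c *\<^sub>R x) = c *\<^sub>R ?f x" by (simp add: scaleR_sum_right)
  qed
qed

lemma linear_extend: "linear (extend t)"
  using linear_extend_graphs[of "\<lambda>G. t (unlabel G)"] by (simp add: extend_def[abs_def])

lemma extend_of_graph [simp]: "extend t (of_graph G) = t (unlabel G)"
  by (simp add: extend_def)

lemma linear_forget_labels: "linear forget_labels"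
  using linear_extend_graphs[of "\<lambda>G. of_graph (unlabel G)"]
  by (simp add: forget_labels_def[abs_def] scaleR_of_graph)

lemma forget_labels_of_graph [simp]: "forget_labels (of_graph G) = of_graph (unlabel G)"
  by (simp add: forget_labels_def)

text \<open>
  \<open>coincide\<close> is congruence modulo this subspace, see \<open>coincide_iff\<close>.
\<close>
definition negligible :: "(lgraph \<Rightarrow>\<^sub>0 real) set" where
  "negligible = {x. coincide x 0}"

lemma negligible_iff:
  "x \<in> negligible \<longleftrightarrow> forget_labels x \<in> span {of_graph (G + K1) - of_graph G |G. G \<in> labeled_graphs 0}"
  by (simp add: negligible_def coincide_def linear_0[OF linear_forget_labels])

lemma subspace_negligible: "subspace negligible"
  unfolding subspace_def
  by (auto simp: negligible_iff linear_0[OF linear_forget_labels] linear_add[OF linear_forget_labels]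
      linear_cmul[OF linear_forget_labels] intro: span_zero span_add span_scale)

lemma coincide_iff: "coincide x y \<longleftrightarrow> x - y \<in> negligible"
  by (simp add: coincide_def negligible_iff linear_diff[OF linear_forget_labels])

lemma negligible_unlabel: "of_graph (unlabel G) - of_graph G \<in> negligible"
  by (simp add: negligible_iff linear_diff[OF linear_forget_labels] span_zero)

lemma negligible_isolated:
  assumes "labels G = {}"
  shows "of_graph (G + K1) - of_graph G \<in> negligible"
proof -
  have "G \<in> labeled_graphs 0" using assms by (simp add: labeled_graphs_def)
  moreover have "unlabel (G + K1) = G + K1" "unlabel G = G"
    using assms by (simp_all add: unlabel_eq_self labels_add)
  ultimately show ?thesis
    by (auto simp: negligible_iff linear_diff[OF linear_forget_labels] intro: span_base)
qed

lemma negligible_trans: "x - y \<in> negligible \<Longrightarrow> y - z \<in> negligible \<Longrightarrow> x - z \<in> negligible"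
  using subspace_add[OF subspace_negligible, of "x - y" "y - z"] by simp

lemma negligible_sym: "x - y \<in> negligible \<Longrightarrow> y - x \<in> negligible"
  using subspace_neg[OF subspace_negligible, of "x - y"] by simp

lemma negligible_add_vertices:
  assumes "finite S"
  shows "of_graph (G + flat_graph S {#}) - of_graph G \<in> negligible"
  using assms
proof induction
  case empty
  have "flat_graph {} {#} = 0" by (simp add: flat_graph_def zero_lgraph_def)
  then show ?case using subspace_0[OF subspace_negligible] by simp
next
  case (insert i S)
  let ?H = "G + flat_graph S {#}"
  have eq: "G + flat_graph (insert i S) {#} = ?H + flat_graph {i} {#}"
    using insert by (simp add: add.assoc flat_graph_add)
  have "of_graph (?H + flat_graph {i} {#}) - of_graph ?H \<in> negligible"
  proof (cases "i \<in> labels ?H")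
    case True
    then show ?thesis using subspace_0[OF subspace_negligible] by (simp add: add_present_vertex)
  next
    case False
    have "of_graph (unlabel ?H + K1) - of_graph (unlabel ?H) \<in> negligible"
      by (rule negligible_isolated) simp
    then show ?thesis
      using negligible_unlabel unlabel_add_new_vertex[OF False]
      by (metis negligible_sym negligible_trans)
  qed
  then show ?case unfolding eq using insert.IH by (rule negligible_trans)
qed

lemma negligible_widen:
  assumes "edges_on S M" "finite T"
  shows "of_graph (flat_graph (S \<union> T) M) - of_graph (flat_graph S M) \<in> negligible"
  using negligible_add_vertices[OF assms(2), of "flat_graph S M"] assms by (simp add: flat_graph_add)

lemma negligible_parallel_edges:
  assumes "finite S" "e \<subseteq> S" "card e = 2"
  shows "of_graph (flat_graph S (replicate_mset j e)) - of_graph (K2 j) \<in> negligible"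
proof -
  have "finite e" using assms finite_subset by blast
  have "of_graph (flat_graph (e \<union> S) (replicate_mset j e)) - of_graph (flat_graph e (replicate_mset j e)) \<in> negligible"
    using assms \<open>finite e\<close> by (intro negligible_widen edges_on_replicate) auto
  moreover have "e \<union> S = S" using assms by auto
  moreover have "of_graph (flat_graph e (replicate_mset j e)) - of_graph (K2 j) \<in> negligible"
    using negligible_sym[OF negligible_unlabel[of "flat_graph e (replicate_mset j e)"]] assms(3)
    by (simp add: unlabel_parallel_edges)
  ultimately show ?thesis using negligible_trans by metis
qed

lemma negligible_edgeless:
  assumes "finite S"
  shows "of_graph (flat_graph S {#}) - 1 \<in> negligible"
  using negligible_add_vertices[OF assms, of 0] by simp

section \<open>Sums of squares of flat elements\<close>

definition flat_cone :: "nat \<Rightarrow> (lgraph \<Rightarrow>\<^sub>0 real) set" where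
  "flat_cone r = {x. \<exists>s\<in>sums_of_squares (flat_algebra r). coincide x s}"

lemma flat_algebra_scaleR: "b \<in> flat_algebra r \<Longrightarrow> c *\<^sub>R b \<in> flat_algebra r"
  by (auto simp: flat_algebra_def in_keys_iff)

lemma flat_algebra_add: "b \<in> flat_algebra r \<Longrightarrow> c \<in> flat_algebra r \<Longrightarrow> b + c \<in> flat_algebra r"
  using keys_add[of b c] by (auto simp: flat_algebra_def)

lemma flat_graph_in_flat_algebra: "edges_on {1..r} M \<Longrightarrow> of_graph (flat_graph {1..r} M) \<in> flat_algebra r"
  by (simp add: flat_algebra_def labeled_graphs_def labels_flat_graph fully_labeled_flat_graph)

lemma scaleR_sum_list: "c *\<^sub>R (\<Sum>b\<leftarrow>bs. f b) = (\<Sum>b\<leftarrow>bs. c *\<^sub>R f b)"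
  for f :: "'a \<Rightarrow> 'b::real_vector"
  by (induction bs) (simp_all add: scaleR_add_right)

lemma convex_cone_flat_cone: "convex_cone (flat_cone r)"
  unfolding convex_cone_iff
proof (intro conjI ballI allI impI)
  show "0 \<in> flat_cone r"
    by (auto simp: flat_cone_def sums_of_squares_def coincide_def span_zero intro!: exI[of _ "[]"])
next
  fix x y assume "x \<in> flat_cone r" "y \<in> flat_cone r"
  then obtain bs cs where "set bs \<subseteq> flat_algebra r" "set cs \<subseteq> flat_algebra r"
    "x - (\<Sum>b\<leftarrow>bs. b\<^sup>2) \<in> negligible" "y - (\<Sum>b\<leftarrow>cs. b\<^sup>2) \<in> negligible"
    by (auto simp: flat_cone_def sums_of_squares_def coincide_iff)
  moreover from subspace_add[OF subspace_negligible this(3,4)]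
  have "x + y - (\<Sum>b\<leftarrow>bs @ cs. b\<^sup>2) \<in> negligible" by (simp add: algebra_simps)
  ultimately show "x + y \<in> flat_cone r"
    unfolding flat_cone_def sums_of_squares_def coincide_iff
    by (intro CollectI bexI[of _ "\<Sum>b\<leftarrow>bs @ cs. b\<^sup>2"] exI[of _ "bs @ cs"]) auto
next
  fix x and c :: real assume "x \<in> flat_cone r" "0 \<le> c"
  then obtain bs where bs: "set bs \<subseteq> flat_algebra r" "x - (\<Sum>b\<leftarrow>bs. b\<^sup>2) \<in> negligible"
    by (auto simp: flat_cone_def sums_of_squares_def coincide_iff)
  have sq: "(sqrt c *\<^sub>R b)\<^sup>2 = c *\<^sub>R b\<^sup>2" for b :: "lgraph \<Rightarrow>\<^sub>0 real"
    using \<open>0 \<le> c\<close> by (simp add: power2_eq_square scaleR_mult)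
  let ?cs = "map (\<lambda>b. sqrt c *\<^sub>R b) bs"
  have "c *\<^sub>R x - (\<Sum>b\<leftarrow>?cs. b\<^sup>2) = c *\<^sub>R (x - (\<Sum>b\<leftarrow>bs. b\<^sup>2))"
    by (simp add: o_def sq scaleR_sum_list scaleR_diff_right)
  then have "c *\<^sub>R x - (\<Sum>b\<leftarrow>?cs. b\<^sup>2) \<in> negligible"
    using subspace_scale[OF subspace_negligible bs(2), of c] by (simp only:)
  then show "c *\<^sub>R x \<in> flat_cone r"
    using bs(1) flat_algebra_scaleR unfolding flat_cone_def sums_of_squares_def coincide_iff
    by (intro CollectI bexI[of _ "\<Sum>b\<leftarrow>?cs. b\<^sup>2"] exI[of _ ?cs]) auto
qed

lemmas flat_cone_add = convex_cone_add[OF convex_cone_flat_cone]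
lemmas flat_cone_scaleR = convex_cone_scaleR[OF convex_cone_flat_cone]

lemma negligible_subset_flat_cone: "x \<in> negligible \<Longrightarrow> x \<in> flat_cone r"
  by (auto simp: flat_cone_def sums_of_squares_def negligible_def intro!: exI[of _ "[]"])

lemma square_in_flat_cone: "b \<in> flat_algebra r \<Longrightarrow> b\<^sup>2 \<in> flat_cone r"
  using subspace_0[OF subspace_negligible]
  by (auto simp: flat_cone_def sums_of_squares_def coincide_iff intro!: bexI[of _ "b\<^sup>2"] exI[of _ "[b]"])

lemma flat_cone_negligible:
  assumes "x \<in> flat_cone r" "y - x \<in> negligible"
  shows "y \<in> flat_cone r"
  using flat_cone_add[OF assms(1) negligible_subset_flat_cone[OF assms(2)]] by simp

text \<open>
  The form in which sums of squares are eliminated: a property that defines a convex cone has to be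
  checked only on negligible elements and on squares.
\<close>
lemma flat_cone_least:
  assumes C: "convex_cone C" and neg: "negligible \<subseteq> C" and sq: "\<And>b. b \<in> flat_algebra r \<Longrightarrow> b\<^sup>2 \<in> C"
  shows "flat_cone r \<subseteq> C"
proof
  fix x assume "x \<in> flat_cone r"
  then obtain bs where bs: "set bs \<subseteq> flat_algebra r" "x - (\<Sum>b\<leftarrow>bs. b\<^sup>2) \<in> negligible"
    by (auto simp: flat_cone_def sums_of_squares_def coincide_iff)
  have "(\<Sum>b\<leftarrow>bs. b\<^sup>2) \<in> C"
    using bs(1) by (induction bs) (auto simp: convex_cone_contains_0[OF C] intro: convex_cone_add[OF C] sq)
  moreover have "x - (\<Sum>b\<leftarrow>bs. b\<^sup>2) \<in> C" using bs(2) neg by blast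
  ultimately show "x \<in> C" using convex_cone_add[OF C] by fastforce
qed

lemma negligible_mult_edgeless:
  assumes "finite S"
  shows "x * of_graph (flat_graph S {#}) - x \<in> negligible"
proof -
  let ?E = "of_graph (flat_graph S {#})"
  have "x * ?E - x = (\<Sum>G\<in>Poly_Mapping.keys x. Poly_Mapping.lookup x G *\<^sub>R of_graph G) * ?E
      - (\<Sum>G\<in>Poly_Mapping.keys x. Poly_Mapping.lookup x G *\<^sub>R of_graph G)"
    by (simp only: graph_expansion)
  also have "\<dots> = (\<Sum>G\<in>Poly_Mapping.keys x. Poly_Mapping.lookup x G *\<^sub>R (of_graph (G + flat_graph S {#}) - of_graph G))"
    unfolding sum_distrib_right sum_subtractf[symmetric]
    by (intro sum.cong refl) (simp add: scaleR_diff_right scaleR_of_graph mult_single)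
  also have "\<dots> \<in> negligible"
    by (intro subspace_sum subspace_scale subspace_negligible negligible_add_vertices assms)
  finally show ?thesis .
qed

text \<open>
  Multiplication by the edgeless graph on the labels \<open>1, \<dots>, s\<close>, which is idempotent, moves a flat
  \<open>r\<close>-labeled element to label set \<open>{1..s}\<close> and changes its square only by isolated vertices.
\<close>
lemma flat_cone_mono:
  assumes "r \<le> s"
  shows "flat_cone r \<subseteq> flat_cone s"
proof (rule flat_cone_least[OF convex_cone_flat_cone])
  show "negligible \<subseteq> flat_cone s" using negligible_subset_flat_cone by blast
  fix b assume b: "b \<in> flat_algebra r"
  let ?E = "of_graph (flat_graph {1..s} {#})"
  have EE: "?E * ?E = ?E" by (simp add: mult_single flat_graph_add)
  have "b * ?E \<in> flat_algebra s"
    unfolding flat_algebra_def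
  proof (rule CollectI, rule subsetI)
    fix G assume "G \<in> Poly_Mapping.keys (b * ?E)"
    then obtain H where H: "H \<in> Poly_Mapping.keys b" "G = H + flat_graph {1..s} {#}"
      using keys_mult[of b ?E] by auto
    then have "labels H = {1..r}" "fully_labeled H"
      using b by (auto simp: flat_algebra_def labeled_graphs_def)
    then show "G \<in> {G \<in> labeled_graphs s. fully_labeled G}"
      using assms unfolding H(2)
      by (auto simp: labeled_graphs_def labels_add labels_flat_graph
          intro!: fully_labeled_add fully_labeled_flat_graph)
  qed
  then have "(b * ?E)\<^sup>2 \<in> flat_cone s" by (rule square_in_flat_cone)
  moreover have "(b * ?E)\<^sup>2 = b\<^sup>2 * ?E"
    by (simp only: power_mult_distrib power2_eq_square[of ?E] EE)
  ultimately have "b\<^sup>2 * ?E \<in> flat_cone s" by (simp only:)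
  then show "b\<^sup>2 \<in> flat_cone s"
    by (rule flat_cone_negligible) (rule negligible_sym[OF negligible_mult_edgeless], simp)
qed

lemma one_in_flat_cone: "1 \<in> flat_cone r"
proof -
  have "of_graph (flat_graph {1..r} {#}) ^ 2 \<in> flat_cone r"
    by (intro square_in_flat_cone flat_graph_in_flat_algebra) simp
  then have "of_graph (flat_graph {1..r} {#}) \<in> flat_cone r"
    by (simp add: power2_eq_square mult_single flat_graph_add)
  then show ?thesis by (rule flat_cone_negligible) (simp add: negligible_sym[OF negligible_edgeless])
qed

section \<open>Bundles of parallel edges\<close>

text \<open>
  Dividing by the power of \<open>d\<close> reduces all bounds to the case \<open>d = 1\<close>.
\<close>
definition scaled_edges :: "real \<Rightarrow> nat \<Rightarrow> lgraph \<Rightarrow>\<^sub>0 real" where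
  "scaled_edges d j = (1 / d ^ j) *\<^sub>R of_graph (K2 j)"

text \<open>
  The power \<open>z ^ j\<close> of the variable \<open>z\<close> for the label pair \<open>{1, 2}\<close>, scaled by \<open>d\<close>. Two labels are
  needed, hence the assumption \<open>2 \<le> s\<close> in what follows.
\<close>
definition edge_power :: "real \<Rightarrow> nat \<Rightarrow> nat \<Rightarrow> lgraph \<Rightarrow>\<^sub>0 real" where
  "edge_power d s j = (1 / d ^ j) *\<^sub>R of_graph (flat_graph {1..s} (replicate_mset j {1, 2}))"

lemma edges_on_first_pair: "2 \<le> s \<Longrightarrow> edges_on {1..s} (replicate_mset j {1, 2})"
  by (intro edges_on_replicate) auto

definition perturbation :: "real \<Rightarrow> nat \<Rightarrow> lgraph \<Rightarrow>\<^sub>0 real" where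
  "perturbation d r = 1 + scaled_edges d (2 * r)"

definition limit_cone :: "real \<Rightarrow> (lgraph \<Rightarrow>\<^sub>0 real) set" where
  "limit_cone d = {x. \<forall>\<epsilon>>0. \<exists>r. x + \<epsilon> *\<^sub>R perturbation d r \<in> flat_cone r}"

context
  fixes d :: real
  assumes d: "0 < d"
begin

lemma edge_power_flat: "2 \<le> s \<Longrightarrow> edge_power d s j \<in> flat_algebra s"
  unfolding edge_power_def by (intro flat_algebra_scaleR flat_graph_in_flat_algebra edges_on_first_pair)

lemma edge_power_mult: "2 \<le> s \<Longrightarrow> edge_power d s i * edge_power d s j = edge_power d s (i + j)"
proof -
  assume s: "2 \<le> s"
  have "replicate_mset i {1::nat, 2} + replicate_mset j {1, 2} = replicate_mset (i + j) {1, 2}"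
    by (rule multiset_eqI) simp
  then show ?thesis
    unfolding edge_power_def scaleR_mult
    by (simp only: mult_single flat_graph_add[OF edges_on_first_pair[OF s] edges_on_first_pair[OF s]]) (simp add: power_add)
qed

lemma edge_power_equiv: "2 \<le> s \<Longrightarrow> edge_power d s j - scaled_edges d j \<in> negligible"
  unfolding edge_power_def scaled_edges_def scaleR_diff_right[symmetric]
  by (intro subspace_scale[OF subspace_negligible] negligible_parallel_edges) auto

lemma scaled_edges_0: "scaled_edges d 0 - 1 \<in> negligible"
proof -
  have "edge_power d 2 0 - 1 \<in> negligible"
    using negligible_edgeless[of "{1..2}"] by (simp add: edge_power_def)
  then show ?thesis using edge_power_equiv[of 2 0] negligible_sym negligible_trans by blast
qed

lemma even_edges_in_flat_cone:
  assumes "2 \<le> s"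
  shows "scaled_edges d (2 * j) \<in> flat_cone s"
proof (rule flat_cone_negligible)
  show "(edge_power d s j)\<^sup>2 \<in> flat_cone s"
    by (intro square_in_flat_cone edge_power_flat assms)
  have "(edge_power d s j)\<^sup>2 = edge_power d s (2 * j)"
    using assms by (simp add: power2_eq_square edge_power_mult mult_2)
  then show "scaled_edges d (2 * j) - (edge_power d s j)\<^sup>2 \<in> negligible"
    using negligible_sym[OF edge_power_equiv[OF assms]] by simp
qed

lemma edges_square_in_flat_cone:
  assumes "2 \<le> s"
  shows "scaled_edges d (2 * i) + (2 * c) *\<^sub>R scaled_edges d (i + j) + c\<^sup>2 *\<^sub>R scaled_edges d (2 * j) \<in> flat_cone s"
proof (rule flat_cone_negligible)
  let ?p = "edge_power d s"
  show "(?p i + c *\<^sub>R ?p j)\<^sup>2 \<in> flat_cone s"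
    by (intro square_in_flat_cone flat_algebra_add flat_algebra_scaleR edge_power_flat assms)
  have "(?p i + c *\<^sub>R ?p j)\<^sup>2 = ?p (2 * i) + (2 * c) *\<^sub>R ?p (i + j) + c\<^sup>2 *\<^sub>R ?p (2 * j)"
    unfolding square_add_scaleR power2_eq_square[of "?p _"] edge_power_mult[OF assms] mult_2[of i] mult_2[of j] ..
  moreover have "(?p (2 * i) - scaled_edges d (2 * i)) + (2 * c) *\<^sub>R (?p (i + j) - scaled_edges d (i + j))
     + c\<^sup>2 *\<^sub>R (?p (2 * j) - scaled_edges d (2 * j)) \<in> negligible"
    by (intro subspace_add subspace_scale subspace_negligible edge_power_equiv assms)
  ultimately have "(?p i + c *\<^sub>R ?p j)\<^sup>2 - (scaled_edges d (2 * i) + (2 * c) *\<^sub>R scaled_edges d (i + j)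
     + c\<^sup>2 *\<^sub>R scaled_edges d (2 * j)) \<in> negligible"
    by (simp add: scaleR_diff_right algebra_simps)
  then show "(scaled_edges d (2 * i) + (2 * c) *\<^sub>R scaled_edges d (i + j)
     + c\<^sup>2 *\<^sub>R scaled_edges d (2 * j)) - (?p i + c *\<^sub>R ?p j)\<^sup>2 \<in> negligible"
    by (rule negligible_sym)
qed

text \<open>
  With \<open>x\<close> for the scaled edge variable, the second difference of the sequence \<open>x ^ (2 * i)\<close> is the
  square of \<open>x ^ i - x ^ (i + 2)\<close>.
\<close>
lemma even_edges_below_chord:
  assumes "2 \<le> s" "k \<le> s"
  shows "(1 - k / s) *\<^sub>R 1 + (k / s) *\<^sub>R scaled_edges d (2 * s) - scaled_edges d (2 * k) \<in> flat_cone s"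
proof -
  have "scaled_edges d (2 * i) - 2 *\<^sub>R scaled_edges d (2 * Suc i) + scaled_edges d (2 * Suc (Suc i)) \<in> flat_cone s" for i
    using edges_square_in_flat_cone[OF assms(1), of i "-1" "Suc (Suc i)"]
    by (simp add: mult_2)
  then have *: "(1 - k / s) *\<^sub>R scaled_edges d (2 * 0) + (k / s) *\<^sub>R scaled_edges d (2 * s) - scaled_edges d (2 * k) \<in> flat_cone s"
    using assms by (intro convex_sequence_below_chord convex_cone_flat_cone) auto
  have "(1 - k / s) *\<^sub>R (1 - scaled_edges d 0) \<in> negligible"
    by (intro subspace_scale[OF subspace_negligible] negligible_sym[OF scaled_edges_0])
  then show ?thesis
    by (intro flat_cone_negligible[OF *]) (simp add: scaleR_diff_right)
qed

text \<open>
  Up to the factor 2, perturbations grow with their index. This allows two elements to be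
  approximated with a common perturbation.
\<close>
lemma perturbation_le:
  assumes "2 \<le> s" "r \<le> s"
  shows "2 *\<^sub>R perturbation d s - perturbation d r \<in> flat_cone s"
proof -
  have rs: "0 \<le> 2 - real r / s"
  proof -
    have "real r / s \<le> 1" using assms by simp
    then show ?thesis by simp
  qed
  have "((1 - r / s) *\<^sub>R 1 + (r / s) *\<^sub>R scaled_edges d (2 * s) - scaled_edges d (2 * r))
      + ((r / s) *\<^sub>R 1 + (2 - r / s) *\<^sub>R scaled_edges d (2 * s)) \<in> flat_cone s"
    by (rule flat_cone_add[OF even_edges_below_chord[OF assms] convex_cone_sum2[OF convex_cone_flat_cone
          one_in_flat_cone even_edges_in_flat_cone[OF assms(1)] _ rs]]) simp
  then show ?thesis by (simp add: perturbation_def algebra_simps scaleR_2)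
qed

section \<open>The cone of approximable elements\<close>

text \<open>
  Approximability asks for a single index; this lemma propagates it to all larger ones, at the price
  of doubling \<open>\<epsilon>\<close>.
\<close>
lemma raise_perturbation:
  assumes "x + \<epsilon> *\<^sub>R perturbation d r \<in> flat_cone r" "0 \<le> \<epsilon>" "2 \<le> s" "r \<le> s"
  shows "x + (2 * \<epsilon>) *\<^sub>R perturbation d s \<in> flat_cone s"
proof -
  have "x + \<epsilon> *\<^sub>R perturbation d r \<in> flat_cone s"
    using assms flat_cone_mono by blast
  moreover have "\<epsilon> *\<^sub>R (2 *\<^sub>R perturbation d s - perturbation d r) \<in> flat_cone s"
    using assms by (intro flat_cone_scaleR perturbation_le)
  ultimately have "(x + \<epsilon> *\<^sub>R perturbation d r) + \<epsilon> *\<^sub>R (2 *\<^sub>R perturbation d s - perturbation d r) \<in> flat_cone s"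
    by (rule flat_cone_add)
  then show ?thesis by (simp add: scaleR_diff_right mult.commute)
qed

lemma limit_coneD:
  assumes "x \<in> limit_cone d" "0 < \<epsilon>"
  obtains r where "2 \<le> r" "\<And>s. r \<le> s \<Longrightarrow> x + \<epsilon> *\<^sub>R perturbation d s \<in> flat_cone s"
proof -
  have "0 < \<epsilon> / 2" using assms by simp
  then obtain q where q: "x + (\<epsilon>/2) *\<^sub>R perturbation d q \<in> flat_cone q"
    using assms unfolding limit_cone_def by blast
  have "x + \<epsilon> *\<^sub>R perturbation d s \<in> flat_cone s" if "max q 2 \<le> s" for s
    using raise_perturbation[OF q, of s] that assms by simp
  then show ?thesis using that[of "max q 2"] by simp
qed

lemma flat_cone_subset_limit_cone:
  assumes "x \<in> flat_cone r"
  shows "x \<in> limit_cone d"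
  unfolding limit_cone_def
proof (intro CollectI allI impI)
  fix \<epsilon> :: real assume "0 < \<epsilon>"
  let ?s = "max r 2"
  have "x \<in> flat_cone ?s" using assms flat_cone_mono[of r ?s] by auto
  moreover have "perturbation d ?s \<in> flat_cone ?s"
    unfolding perturbation_def
    by (intro flat_cone_add one_in_flat_cone even_edges_in_flat_cone) simp
  ultimately show "\<exists>r. x + \<epsilon> *\<^sub>R perturbation d r \<in> flat_cone r"
    using \<open>0 < \<epsilon>\<close> by (intro exI[of _ ?s] flat_cone_add
        flat_cone_scaleR) auto
qed

lemma convex_cone_limit_cone: "convex_cone (limit_cone d)"
  unfolding convex_cone_iff
proof (intro conjI ballI allI impI)
  show "0 \<in> limit_cone d"
    by (rule flat_cone_subset_limit_cone[OF convex_cone_contains_0[OF convex_cone_flat_cone]])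
next
  fix x y assume xy: "x \<in> limit_cone d" "y \<in> limit_cone d"
  show "x + y \<in> limit_cone d"
    unfolding limit_cone_def
  proof (intro CollectI allI impI)
    fix \<epsilon> :: real assume "0 < \<epsilon>"
    then have "0 < \<epsilon> / 2" by simp
    then obtain q r where q: "\<And>s. q \<le> s \<Longrightarrow> x + (\<epsilon>/2) *\<^sub>R perturbation d s \<in> flat_cone s"
      and r: "\<And>s. r \<le> s \<Longrightarrow> y + (\<epsilon>/2) *\<^sub>R perturbation d s \<in> flat_cone s"
      using limit_coneD xy by metis
    then have "(x + (\<epsilon>/2) *\<^sub>R perturbation d (max q r)) + (y + (\<epsilon>/2) *\<^sub>R perturbation d (max q r)) \<in> flat_cone (max q r)"
      by (intro flat_cone_add[OF q r]) simp_all
    moreover have "(x + (\<epsilon>/2) *\<^sub>R z) + (y + (\<epsilon>/2) *\<^sub>R z) = x + y + \<epsilon> *\<^sub>R z" for z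
    proof -
      have "(\<epsilon>/2) *\<^sub>R z + (\<epsilon>/2) *\<^sub>R z = \<epsilon> *\<^sub>R z" by (metis scaleR_add_left field_sum_of_halves)
      then show ?thesis by (simp add: algebra_simps)
    qed
    ultimately show "\<exists>r. x + y + \<epsilon> *\<^sub>R perturbation d r \<in> flat_cone r" by auto
  qed
next
  fix x and c :: real assume x: "x \<in> limit_cone d" and "0 \<le> c"
  show "c *\<^sub>R x \<in> limit_cone d"
  proof (cases "c = 0")
    case True
    then show ?thesis
      using flat_cone_subset_limit_cone[OF convex_cone_contains_0[OF convex_cone_flat_cone]] by simp
  next
    case False
    show ?thesis
      unfolding limit_cone_def
    proof (intro CollectI allI impI)
      fix \<epsilon> :: real assume "0 < \<epsilon>"
      then obtain r where "x + (\<epsilon> / c) *\<^sub>R perturbation d r \<in> flat_cone r"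
        using x False \<open>0 \<le> c\<close> unfolding limit_cone_def by force
      then have "c *\<^sub>R (x + (\<epsilon> / c) *\<^sub>R perturbation d r) \<in> flat_cone r"
        using \<open>0 \<le> c\<close> by (intro flat_cone_scaleR)
      then show "\<exists>r. c *\<^sub>R x + \<epsilon> *\<^sub>R perturbation d r \<in> flat_cone r"
        using False by (auto simp: scaleR_add_right)
    qed
  qed
qed

text \<open>
  The error \<open>\<delta>\<close> is absorbed by a further \<open>\<delta>\<close> times the perturbation, which exceeds \<open>1\<close> by an even
  power and hence by a square.
\<close>
lemma limit_cone_closed:
  assumes "\<And>\<delta>. 0 < \<delta> \<Longrightarrow> x + \<delta> *\<^sub>R 1 \<in> limit_cone d"
  shows "x \<in> limit_cone d"
  unfolding limit_cone_def
proof (intro CollectI allI impI)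
  fix \<epsilon> :: real assume "0 < \<epsilon>"
  then have "0 < \<epsilon> / 2" by simp
  with assms obtain r where r: "2 \<le> r" "x + (\<epsilon>/2) *\<^sub>R 1 + (\<epsilon>/2) *\<^sub>R perturbation d r \<in> flat_cone r"
    using limit_coneD by (metis order_refl)
  have "(x + (\<epsilon>/2) *\<^sub>R 1 + (\<epsilon>/2) *\<^sub>R perturbation d r) + (\<epsilon>/2) *\<^sub>R scaled_edges d (2 * r) \<in> flat_cone r"
    using \<open>0 < \<epsilon>\<close>
    by (intro flat_cone_add[OF r(2) flat_cone_scaleR[OF _ even_edges_in_flat_cone[OF r(1)]]]) simp
  also have "(x + (\<epsilon>/2) *\<^sub>R 1 + (\<epsilon>/2) *\<^sub>R perturbation d r) + (\<epsilon>/2) *\<^sub>R scaled_edges d (2 * r)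
    = x + ((\<epsilon>/2) *\<^sub>R perturbation d r + (\<epsilon>/2) *\<^sub>R perturbation d r)"
    by (simp add: perturbation_def scaleR_add_right)
  also have "\<dots> = x + \<epsilon> *\<^sub>R perturbation d r"
    by (metis scaleR_add_left field_sum_of_halves)
  finally show "\<exists>r. x + \<epsilon> *\<^sub>R perturbation d r \<in> flat_cone r" ..
qed

lemma even_edges_le_one: "1 - scaled_edges d (2 * k) \<in> limit_cone d"
  unfolding limit_cone_def
proof (intro CollectI allI impI)
  fix \<epsilon> :: real assume "0 < \<epsilon>"
  \<comment> \<open>The coefficient \<open>k / s\<close> of the top power must be at most \<open>\<epsilon>\<close>.\<close>
  define s where "s = max (max 2 k) (nat \<lceil>k / \<epsilon>\<rceil>)"
  have s: "2 \<le> s" "k \<le> s" by (auto simp: s_def)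
  have "k / \<epsilon> \<le> s" by (rule order_trans[OF real_nat_ceiling_ge]) (simp add: s_def)
  then have ks: "k / s \<le> \<epsilon>" using \<open>0 < \<epsilon>\<close> s(1) by (simp add: field_simps)
  have "((1 - k / s) *\<^sub>R 1 + (k / s) *\<^sub>R scaled_edges d (2 * s) - scaled_edges d (2 * k))
      + ((k / s + \<epsilon>) *\<^sub>R 1 + (\<epsilon> - k / s) *\<^sub>R scaled_edges d (2 * s)) \<in> flat_cone s"
    using ks \<open>0 < \<epsilon>\<close>
    by (intro flat_cone_add[OF even_edges_below_chord[OF s] convex_cone_sum2[OF convex_cone_flat_cone
          one_in_flat_cone even_edges_in_flat_cone[OF s(1)]]]) simp_all
  then have "1 - scaled_edges d (2 * k) + \<epsilon> *\<^sub>R perturbation d s \<in> flat_cone s"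
    by (simp add: perturbation_def algebra_simps)
  then show "\<exists>r. 1 - scaled_edges d (2 * k) + \<epsilon> *\<^sub>R perturbation d r \<in> flat_cone r" ..
qed

lemma limit_cone_negligible: "x \<in> limit_cone d \<Longrightarrow> y - x \<in> negligible \<Longrightarrow> y \<in> limit_cone d"
  using convex_cone_add[OF convex_cone_limit_cone, of x "y - x"]
    flat_cone_subset_limit_cone[OF negligible_subset_flat_cone] by fastforce

text \<open>
  With \<open>x\<close> for the scaled edge variable,
  \<open>2 * (1 \<plusminus> x ^ k) = (1 \<plusminus> x ^ k)\<^sup>2 + (1 - x ^ (2 * k))\<close>, which reduces odd powers to even ones.
\<close>
lemma edges_bounded_by_one:
  assumes "\<bar>c\<bar> = 1"
  shows "1 + c *\<^sub>R scaled_edges d k \<in> limit_cone d"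
proof -
  have c2: "c\<^sup>2 = 1" using assms by (metis power2_abs one_power2)
  have "scaled_edges d (2 * 0) + (2 * c) *\<^sub>R scaled_edges d (0 + k) + c\<^sup>2 *\<^sub>R scaled_edges d (2 * k) \<in> limit_cone d"
    by (rule flat_cone_subset_limit_cone[OF edges_square_in_flat_cone[of 2]]) simp
  then have "(1/2) *\<^sub>R (scaled_edges d 0 + (2 * c) *\<^sub>R scaled_edges d k + scaled_edges d (2 * k))
      + (1/2) *\<^sub>R (1 - scaled_edges d (2 * k)) \<in> limit_cone d"
    by (intro convex_cone_sum2 convex_cone_limit_cone even_edges_le_one) (simp_all add: c2)
  then show ?thesis
  proof (rule limit_cone_negligible)
    have "(1/2) *\<^sub>R (1 - scaled_edges d 0) \<in> negligible"
      by (intro subspace_scale[OF subspace_negligible] negligible_sym[OF scaled_edges_0])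
    moreover have "1 + c *\<^sub>R scaled_edges d k - ((1/2) *\<^sub>R (scaled_edges d 0 + (2 * c) *\<^sub>R scaled_edges d k + scaled_edges d (2 * k))
      + (1/2) *\<^sub>R (1 - scaled_edges d (2 * k))) = (1/2) *\<^sub>R (1 - scaled_edges d 0)"
    proof -
      have "(1/2) *\<^sub>R 1 + (1/2) *\<^sub>R 1 = (1 :: lgraph \<Rightarrow>\<^sub>0 real)"
        by (metis scaleR_add_left field_sum_of_halves scaleR_one)
      then show ?thesis by (simp add: algebra_simps)
    qed
    ultimately show "1 + c *\<^sub>R scaled_edges d k - ((1/2) *\<^sub>R (scaled_edges d 0 + (2 * c) *\<^sub>R scaled_edges d k + scaled_edges d (2 * k))
      + (1/2) *\<^sub>R (1 - scaled_edges d (2 * k))) \<in> negligible" by simp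
  qed
qed

text \<open>
  For \<open>c = - 1\<close> this is \<open>2xy \<le> x\<^sup>2 + y\<^sup>2\<close> for monomials \<open>x\<close> and \<open>y\<close>, and for \<open>c = 1\<close> the
  corresponding lower bound.
\<close>
lemma square_of_two_graphs_in_limit_cone:
  assumes "edges_on {1..k} M" "edges_on {1..k} N" and c: "\<bar>c\<bar> = 1"
  shows "of_graph (flat_graph {1..k} (M + M)) + of_graph (flat_graph {1..k} (N + N))
       + (2 * c) *\<^sub>R of_graph (flat_graph {1..k} (M + N)) \<in> limit_cone d"
proof -
  let ?m = "\<lambda>M. of_graph (flat_graph {1..k} M)"
  have cc: "c * c = 1" using c by (metis abs_mult_self_eq mult_1)
  have mult: "?m M * ?m N = ?m (M + N)" if "edges_on {1..k} M" "edges_on {1..k} N" for M N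
    using flat_graph_add[OF that] by (simp add: mult_single)
  have "(?m M + c *\<^sub>R ?m N)\<^sup>2 \<in> flat_cone k"
    by (intro square_in_flat_cone flat_algebra_add flat_algebra_scaleR flat_graph_in_flat_algebra assms)
  moreover have "(?m M + c *\<^sub>R ?m N)\<^sup>2 = ?m (M + M) + ?m (N + N) + (2 * c) *\<^sub>R ?m (M + N)"
    unfolding square_add_scaleR
    by (simp only: power2_eq_square mult[OF assms(1,1)] mult[OF assms(2,2)] mult[OF assms(1,2)] cc scaleR_one add_ac)
  ultimately show ?thesis using flat_cone_subset_limit_cone by simp
qed

text \<open>
  With \<open>z\<close> for the edge \<open>e\<close> and \<open>m\<close> for the product of the remaining edges,
  \<open>2 * (z * m) ^ (2 * p) \<le> z ^ (4 * p) + m ^ (4 * p)\<close>. Splitting off an edge doubles the exponent, so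
  the claim is proved for all even exponents at once.
\<close>
lemma even_graph_bounded:
  assumes "edges_on {1..k} M"
  shows "\<exists>N. N *\<^sub>R 1 - of_graph (flat_graph {1..k} (repeat_mset (2 * p) M)) \<in> limit_cone d"
  using assms
proof (induction M arbitrary: p)
  case empty
  have "1 - of_graph (flat_graph {1..k} {#}) \<in> limit_cone d"
    by (intro flat_cone_subset_limit_cone[OF negligible_subset_flat_cone] negligible_sym[OF negligible_edgeless]) simp
  then show ?case by (intro exI[of _ 1]) simp
next
  case (add e M)
  let ?m = "\<lambda>M. of_graph (flat_graph {1..k} M)"
  have M: "edges_on {1..k} M" and e: "e \<subseteq> {1..k}" "card e = 2"
    using add.prems by (auto simp: edges_on_def)
  let ?A = "replicate_mset (2 * p) e" and ?B = "repeat_mset (2 * p) M"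
  have A: "edges_on {1..k} ?A" using e by (intro edges_on_replicate) auto
  have B: "edges_on {1..k} ?B" by (rule edges_on_repeat[OF M])
  obtain N where N: "N *\<^sub>R 1 - ?m (repeat_mset (2 * (2 * p)) M) \<in> limit_cone d"
    using add.IH M by blast
  have AA: "?A + ?A = replicate_mset (2 * (2 * p)) e" and BB: "?B + ?B = repeat_mset (2 * (2 * p)) M"
    by (auto simp: multiset_eq_iff)
  \<comment> \<open>A power of the single edge \<open>e\<close> is a bundle of parallel edges up to labels and isolated vertices.\<close>
  have "1 - scaled_edges d (2 * (2 * p)) \<in> limit_cone d" by (rule even_edges_le_one)
  then have "d ^ (2 * (2 * p)) *\<^sub>R (1 - scaled_edges d (2 * (2 * p))) \<in> limit_cone d"
    using d by (intro convex_cone_scaleR[OF convex_cone_limit_cone]) auto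
  then have "d ^ (2 * (2 * p)) *\<^sub>R 1 - of_graph (K2 (2 * (2 * p))) \<in> limit_cone d"
    using d by (simp add: scaled_edges_def scaleR_diff_right)
  then have N': "d ^ (2 * (2 * p)) *\<^sub>R 1 - ?m (?A + ?A) \<in> limit_cone d"
    unfolding AA
  proof (rule limit_cone_negligible)
    have "of_graph (K2 (2 * (2 * p))) - ?m (replicate_mset (2 * (2 * p)) e) \<in> negligible"
      using e by (intro negligible_sym[OF negligible_parallel_edges]) auto
    then show "d ^ (2 * (2 * p)) *\<^sub>R 1 - ?m (replicate_mset (2 * (2 * p)) e)
       - (d ^ (2 * (2 * p)) *\<^sub>R 1 - of_graph (K2 (2 * (2 * p)))) \<in> negligible" by simp
  qed
  have "(1/2) *\<^sub>R (((d ^ (2 * (2 * p)) *\<^sub>R 1 - ?m (?A + ?A)) + (N *\<^sub>R 1 - ?m (?B + ?B)))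
      + (?m (?A + ?A) + ?m (?B + ?B) + (2 * (-1)) *\<^sub>R ?m (?A + ?B))) \<in> limit_cone d"
    using N' N unfolding BB[symmetric]
    by (intro convex_cone_scaleR[OF convex_cone_limit_cone] convex_cone_add[OF convex_cone_limit_cone]
        square_of_two_graphs_in_limit_cone A B) auto
  also have "(1/2) *\<^sub>R (((d ^ (2 * (2 * p)) *\<^sub>R 1 - ?m (?A + ?A)) + (N *\<^sub>R 1 - ?m (?B + ?B)))
      + (?m (?A + ?A) + ?m (?B + ?B) + (2 * (-1)) *\<^sub>R ?m (?A + ?B)))
      = ((d ^ (2 * (2 * p)) + N) / 2) *\<^sub>R 1 - ?m (?A + ?B)"
    by (simp add: algebra_simps add_divide_distrib)
  finally show ?case by auto
qed

text \<open>
  With \<open>m\<close> for the monomial obtained by labeling all vertices of \<open>G\<close>, \<open>2 * c * m \<le> 1 + m\<^sup>2\<close>.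
\<close>
lemma graph_bounded:
  assumes "\<bar>c\<bar> = 1"
  shows "\<exists>N. N *\<^sub>R 1 - c *\<^sub>R of_graph G \<in> limit_cone d"
proof -
  obtain k M where M: "edges_on {1..k} M" and eq: "unlabel G = unlabel (flat_graph {1..k} M)"
    by (rule unlabel_eq_unlabel_flat_graph)
  let ?m = "\<lambda>M. of_graph (flat_graph {1..k} M)"
  obtain N where "N *\<^sub>R 1 - ?m (repeat_mset (2 * 1) M) \<in> limit_cone d"
    using even_graph_bounded[OF M, of 1] by blast
  then have N: "N *\<^sub>R 1 - ?m (M + M) \<in> limit_cone d" by (simp add: numeral_2_eq_2)
  have "?m ({#} + {#}) + ?m (M + M) + (2 * (- c)) *\<^sub>R ?m ({#} + M) \<in> limit_cone d"
    using assms M by (intro square_of_two_graphs_in_limit_cone) auto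
  from convex_cone_scaleR[OF convex_cone_limit_cone _ convex_cone_add[OF convex_cone_limit_cone this N], of "1/2"]
  have "(1/2) *\<^sub>R (?m {#} + N *\<^sub>R 1 - (2 * c) *\<^sub>R ?m M) \<in> limit_cone d"
    by (simp add: algebra_simps)
  then have "((1 + N) / 2) *\<^sub>R 1 - c *\<^sub>R of_graph G \<in> limit_cone d"
  proof (rule limit_cone_negligible)
    have "1 - ?m {#} \<in> negligible" by (rule negligible_sym[OF negligible_edgeless]) simp
    moreover have "?m M - of_graph G \<in> negligible"
      by (metis eq negligible_sym negligible_trans negligible_unlabel)
    ultimately have "(1/2) *\<^sub>R (1 - ?m {#}) + c *\<^sub>R (?m M - of_graph G) \<in> negligible"
      by (intro subspace_add subspace_scale subspace_negligible)
    then show "((1 + N) / 2) *\<^sub>R 1 - c *\<^sub>R of_graph G - (1/2) *\<^sub>R (?m {#} + N *\<^sub>R 1 - (2 * c) *\<^sub>R ?m M) \<in> negligible"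
      by (simp add: algebra_simps add_divide_distrib)
  qed
  then show ?thesis by blast
qed

text \<open>
  Bounded elements form a cone, so it is enough to bound every graph from both sides.
\<close>
lemma order_unit_one: "\<exists>N. N *\<^sub>R 1 - x \<in> limit_cone d"
proof -
  let ?B = "{x. \<exists>N. N *\<^sub>R 1 - x \<in> limit_cone d}"
  have add: "x + y \<in> ?B" if xy: "x \<in> ?B" "y \<in> ?B" for x y
  proof -
    obtain N N' where "N *\<^sub>R 1 - x \<in> limit_cone d" "N' *\<^sub>R 1 - y \<in> limit_cone d" using xy by blast
    from convex_cone_add[OF convex_cone_limit_cone this]
    have "(N + N') *\<^sub>R 1 - (x + y) \<in> limit_cone d" by (simp add: algebra_simps)
    then show ?thesis by blast
  qed
  have zero: "0 \<in> ?B"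
    using convex_cone_contains_0[OF convex_cone_limit_cone] by (auto intro!: exI[of _ 0])
  have graph: "c *\<^sub>R of_graph G \<in> ?B" for c G
  proof -
    obtain N where "N *\<^sub>R 1 - sgn c *\<^sub>R of_graph G \<in> limit_cone d"
    proof (cases "c = 0")
      case True
      then show ?thesis using zero that by auto
    next
      case False
      then have "\<bar>sgn c\<bar> = 1" by (simp add: abs_sgn_eq)
      then show ?thesis using graph_bounded that by blast
    qed
    then have "\<bar>c\<bar> *\<^sub>R (N *\<^sub>R 1 - sgn c *\<^sub>R of_graph G) \<in> limit_cone d"
      by (intro convex_cone_scaleR[OF convex_cone_limit_cone]) auto
    then have "(\<bar>c\<bar> * N) *\<^sub>R 1 - c *\<^sub>R of_graph G \<in> limit_cone d"
      by (simp add: scaleR_diff_right abs_mult_sgn)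
    then show ?thesis by blast
  qed
  have "(\<Sum>G\<in>S. Poly_Mapping.lookup x G *\<^sub>R of_graph G) \<in> ?B" if "finite S" for S
    using that
  proof induction
    case empty
    then show ?case using zero by simp
  next
    case (insert G S)
    then show ?case using add[OF graph insert.IH] by simp
  qed
  from this[of "Poly_Mapping.keys x"] show ?thesis by (simp add: graph_expansion)
qed

end

section \<open>Positive functionals and graph parameters\<close>

lemma negligible_forget_labels: "forget_labels x - x \<in> negligible"
proof -
  have "forget_labels (forget_labels x) = forget_labels x"
    by (rule linear_eq_on_graphs[OF linear_compose[OF linear_forget_labels linear_forget_labels, unfolded o_def]
          linear_forget_labels]) simp
  then show ?thesis by (simp add: negligible_iff linear_diff[OF linear_forget_labels] span_zero)
qed

lemma extend_negligible:
  assumes "isolate_indifferent t" "x \<in> negligible"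
  shows "extend t x = 0"
proof -
  have "extend t (forget_labels x) = 0"
  proof (rule linear_eq_0_on_span[OF linear_extend])
    show "forget_labels x \<in> span {of_graph (G + K1) - of_graph G |G. G \<in> labeled_graphs 0}"
      using assms(2) by (simp add: negligible_iff)
    fix y assume "y \<in> {of_graph (G + K1) - of_graph G |G. G \<in> labeled_graphs 0}"
    then obtain G where y: "y = of_graph (G + K1) - of_graph G" and G: "G \<in> labeled_graphs 0" by blast
    then have "labels G = {}" by (simp add: labeled_graphs_def)
    then show "extend t y = 0"
      using assms(1) G
      by (simp add: y linear_diff[OF linear_extend] unlabel_eq_self labels_add isolate_indifferent_def)
  qed
  moreover have "extend t (forget_labels x) = extend t x"
    by (rule linear_eq_on_graphs[OF linear_compose[OF linear_forget_labels linear_extend, unfolded o_def]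
          linear_extend]) simp
  ultimately show ?thesis by simp
qed

lemma extend_nonneg_on_flat_cone:
  assumes "isolate_indifferent t" "flatly_reflection_positive t" "x \<in> flat_cone r"
  shows "0 \<le> extend t x"
proof -
  have "flat_cone r \<subseteq> {x. 0 \<le> extend t x}"
  proof (rule flat_cone_least)
    show "convex_cone {x. 0 \<le> extend t x}"
      by (simp add: convex_cone_iff linear_0[OF linear_extend] linear_add[OF linear_extend]
          linear_cmul[OF linear_extend])
    show "negligible \<subseteq> {x. 0 \<le> extend t x}"
      using extend_negligible[OF assms(1)] by auto
    show "\<And>b. b \<in> flat_algebra r \<Longrightarrow> b\<^sup>2 \<in> {x. 0 \<le> extend t x}"
      using assms(2) by (simp add: flatly_reflection_positive_def)
  qed
  then show ?thesis using assms(3) by blast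
qed

lemma limit_cone_sound:
  assumes d: "0 < d" and t: "isolate_indifferent t" "flatly_reflection_positive t" "bounded_parameter d t"
    and x: "x \<in> limit_cone d"
  shows "0 \<le> extend t x"
proof (rule field_le_epsilon)
  fix \<epsilon> :: real assume "0 < \<epsilon>"
  then have "0 < \<epsilon> / 2" by simp
  then obtain r where "x + (\<epsilon>/2) *\<^sub>R perturbation d r \<in> flat_cone r"
    using x unfolding limit_cone_def by blast
  then have "0 \<le> extend t (x + (\<epsilon>/2) *\<^sub>R perturbation d r)"
    by (rule extend_nonneg_on_flat_cone[OF t(1,2)])
  also have "\<dots> = extend t x + (\<epsilon>/2) * (t 0 + t (K2 (2 * r)) / d ^ (2 * r))"
  proof -
    have "extend t 1 = t 0" using extend_of_graph[of t 0] by (simp add: unlabel_eq_self)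
    then show ?thesis
      by (simp add: perturbation_def scaled_edges_def linear_add[OF linear_extend]
          linear_cmul[OF linear_extend] unlabel_eq_self)
  qed
  also have "\<dots> \<le> extend t x + (\<epsilon>/2) * 2"
  proof -
    have iso: "t (G + K1) = t G" if "labels G = {}" for G
      using t(1) that by (simp add: isolate_indifferent_def labeled_graphs_def)
    \<comment> \<open>\<open>K2 0\<close> consists of two isolated vertices, so boundedness at \<open>k = 0\<close> controls the value at the empty
      graph.\<close>
    have "t 0 = t (K2 0)"
      using iso[of 0] iso[of K1] by (simp add: K2_0)
    moreover have b: "\<bar>t (K2 k)\<bar> \<le> d ^ k" for k using t(3) by (simp add: bounded_parameter_def)
    ultimately have "t 0 \<le> 1" using b[of 0] by simp
    moreover have "t (K2 (2 * r)) / d ^ (2 * r) \<le> 1"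
      using b[of "2 * r"] d by (simp add: divide_le_eq)
    ultimately show ?thesis using \<open>0 < \<epsilon>\<close> by (intro add_left_mono mult_left_mono) auto
  qed
  finally show "0 \<le> extend t x + \<epsilon>" by simp
qed

text \<open>
  The functional is defined on labeled graphs as well. It ignores negligible elements, hence labels,
  and so it agrees with the extension of its restriction to unlabeled graphs.
\<close>
lemma limit_cone_complete:
  assumes d: "0 < d" and a: "a \<notin> limit_cone d"
  obtains t where "isolate_indifferent t" "flatly_reflection_positive t" "bounded_parameter d t" "extend t a < 0"
proof -
  obtain \<epsilon> where \<epsilon>: "0 < \<epsilon>" "a + \<epsilon> *\<^sub>R 1 \<notin> limit_cone d"
    using limit_cone_closed[OF d] a by blast
  have "1 \<in> limit_cone d"
    by (rule flat_cone_subset_limit_cone[OF d one_in_flat_cone])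
  then obtain f :: "(lgraph \<Rightarrow>\<^sub>0 real) \<Rightarrow> real"
    where lin: "linear f" and pos: "\<And>x. x \<in> limit_cone d \<Longrightarrow> 0 \<le> f x" and fa: "f a < 0" and f1: "f 1 = 1"
    using order_unit_separation[OF convex_cone_limit_cone[OF d] _ order_unit_one[OF d] \<epsilon>(2,1)] by metis
  define t where "t G = f (of_graph G)" for G
  have neg: "f x = f y" if "x - y \<in> negligible" for x y
  proof -
    have "z \<in> limit_cone d" if "z \<in> negligible" for z
      by (rule flat_cone_subset_limit_cone[OF d negligible_subset_flat_cone[OF that]])
    then have "0 \<le> f (x - y)" "0 \<le> f (y - x)" using that negligible_sym pos by blast+
    then show ?thesis by (simp add: linear_diff[OF lin])
  qed
  have ext: "extend t x = f x" for x
  proof -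
    have "extend t x = f (forget_labels x)"
      by (rule linear_eq_on_graphs[OF linear_extend linear_compose[OF linear_forget_labels lin, unfolded o_def]])
        (simp add: t_def)
    also have "\<dots> = f x" by (rule neg[OF negligible_forget_labels])
    finally show ?thesis .
  qed
  have "isolate_indifferent t"
    unfolding isolate_indifferent_def t_def
    by (auto intro!: neg negligible_isolated simp: labeled_graphs_def)
  moreover have "flatly_reflection_positive t"
    unfolding flatly_reflection_positive_def ext
    using pos flat_cone_subset_limit_cone[OF d square_in_flat_cone] by blast
  moreover have "bounded_parameter d t"
    unfolding bounded_parameter_def
  proof
    fix k
    have e: "f (scaled_edges d k) = t (K2 k) / d ^ k"
      by (simp add: scaled_edges_def t_def linear_cmul[OF lin])
    have "0 \<le> f (1 + 1 *\<^sub>R scaled_edges d k)" "0 \<le> f (1 + (- 1) *\<^sub>R scaled_edges d k)"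
      by (intro pos edges_bounded_by_one[OF d]; simp)+
    then have "\<bar>t (K2 k) / d ^ k\<bar> \<le> 1"
      using f1 e by (simp add: linear_add[OF lin] linear_diff[OF lin])
    then show "\<bar>t (K2 k)\<bar> \<le> d ^ k" using d by (simp add: abs_divide divide_le_eq)
  qed
  ultimately show ?thesis using that fa ext by simp
qed

theorem theorem3p8:
  fixes d :: real and a :: "lgraph \<Rightarrow>\<^sub>0 real"
  assumes "d > 0" and "a \<in> quantum_multigraphs"
  shows "(\<forall>t. isolate_indifferent t \<and> flatly_reflection_positive t \<and> bounded_parameter d t
              \<longrightarrow> extend t a \<ge> 0)
     \<longleftrightarrow> (\<forall>\<epsilon>>0. \<exists>r::nat. \<exists>s\<in>sums_of_squares (flat_algebra r).
              coincide (a + \<epsilon> *\<^sub>R (1 + (1 / d ^ (2 * r)) *\<^sub>R of_graph (K2 (2 * r)))) s)"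
    (is "?positive \<longleftrightarrow> ?approximable")
proof -
  have "?approximable \<longleftrightarrow> a \<in> limit_cone d"
    by (simp add: limit_cone_def flat_cone_def perturbation_def scaled_edges_def)
  moreover have "?positive \<longleftrightarrow> a \<in> limit_cone d"
  proof
    assume "?positive"
    then show "a \<in> limit_cone d"
      using limit_cone_complete[OF assms(1)] by (metis not_le)
  next
    assume "a \<in> limit_cone d"
    then show "?positive"
      using limit_cone_sound[OF assms(1)] by blast
  qed
  ultimately show ?thesis by blast
qed

end
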